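(* The composition $$H^{\mathrm{Lie}}_*(W^P_1)\xrightarrow{\ \mu_2\ }H^{\mathrm{Lie}}_*(U(W^P_1))\xrightarrow{\ \theta_*\ }HC_{*-1}(U(W^P_1))$$ detects the Godbillon-Vey invariant, i.e., the map $$\theta_*\circ\mu_2:H^{\mathrm{Lie}}_3(W^P_1)\to HC_2(U(W^P_1))$$ is injective.
   Context: $W^P_1=\mathbf R[x]\otimes_{\mathbf R}\langle\frac{d}{dx}\rangle$ is the real Lie algebra of polynomial vector fields in one variable, $[x^n\frac{d}{dx},x^k\frac{d}{dx}]=(k-n)x^{n+k-1}\frac{d}{dx}$; $e_i=x^{i+1}\frac{d}{dx}$ for $i\ge-1$. $U(W^P_1)$ is its universal enveloping algebra, also regarded as a Lie algebra via $[a,b]=ab-ba$; $\mu_2$ is induced by the inclusion of Lie algebras $W^P_1\hookrightarrow U(W^P_1)$. The Godbillon-Vey class in $H^{\mathrm{Lie}}_3(W^P_1)$ is the class of the cycle $e_{-1}\wedge e_0\wedge e_1$. $H^{\mathrm{Lie}}_*(\mathsf g)$ is the homology of $\Lambda^*(\mathsf g)$, with $\mathsf g^{\wedge n}$ in degree $n$ and $d(g_1\wedge\cdots\wedge g_n)=\sum_{i<j}(-1)^jg_1\wedge\cdots\wedge g_{i-1}\wedge[g_i,g_j]\wedge g_{i+1}\wedge\cdots\hat g_j\cdots\wedge g_n$. For an algebra $A$ over $\mathbf R$, $HC_*(A)$ is the homology of $C^\lambda_n(A)=A^{\otimes(n+1)}/\operatorname{Im}(1-t)$, $t(a_0,\ldots,a_n)=(-1)^n(a_n,a_0,\ldots,a_{n-1})$,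 with boundary induced by the Hochschild boundary $b(a_0,\ldots,a_n)=\sum_{i=0}^{n-1}(-1)^i(a_0,\ldots,a_ia_{i+1},\ldots,a_n)+(-1)^n(a_na_0,a_1,\ldots,a_{n-1})$. $\theta_*:H^{\mathrm{Lie}}_{*+1}(A)\to HC_*(A)$ is induced by the chain map $\theta(a_0\wedge\cdots\wedge a_n)=\sum_{\sigma\in S_n}(\operatorname{sgn}\sigma)(a_0,a_{\sigma^{-1}(1)},\ldots,a_{\sigma^{-1}(n)})$. *)

theory Defs
  imports
    Complex_Main
    "HOL-Library.Poly_Mapping"
    "HOL-Computational_Algebra.Polynomial"
    "HOL-Combinatorics.Permutations"
begin

section \<open>Tensor algebra of a real vector space\<close>

instantiation poly_mapping :: (type, real_vector) real_vector
begin

lift_definition scaleR_poly_mapping :: "real \<Rightarrow> ('a \<Rightarrow>\<^sub>0 'b) \<Rightarrow> ('a \<Rightarrow>\<^sub>0 'b)"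
  is "\<lambda>r f k. r *\<^sub>R f k"
  by (rule finite_subset) auto

instance
  by standard (transfer; simp add: fun_eq_iff algebra_simps)+

end

text \<open>
  \<open>'b \<Rightarrow>\<^sub>0 real\<close> is the real vector space with basis \<open>'b\<close>; a basis element \<open>k\<close> is
  \<open>Poly_Mapping.single k 1\<close>, and \<open>free_lift f\<close> is the linear extension of \<open>f\<close>.
\<close>

definition free_lift :: "('b \<Rightarrow> 'v::real_vector) \<Rightarrow> ('b \<Rightarrow>\<^sub>0 real) \<Rightarrow> 'v" where
  "free_lift f x = (\<Sum>k\<in>Poly_Mapping.keys x. Poly_Mapping.lookup x k *\<^sub>R f k)"

lemma lookup_scaleR [simp]: "Poly_Mapping.lookup (r *\<^sub>R x) k = r *\<^sub>R Poly_Mapping.lookup x k"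
  by transfer simp

lemma free_lift_superset:
  assumes "finite K" "Poly_Mapping.keys x \<subseteq> K"
  shows "free_lift f x = (\<Sum>k\<in>K. Poly_Mapping.lookup x k *\<^sub>R f k)"
  unfolding free_lift_def using assms
  by (intro sum.mono_neutral_left) (auto simp: in_keys_iff)

lemma free_lift_single [simp]: "free_lift f (Poly_Mapping.single k r) = r *\<^sub>R f k"
  by (subst free_lift_superset[of "{k}"]) auto

lemma linear_free_lift: "linear (free_lift f)"
proof (rule linearI)
  fix x y :: "'a \<Rightarrow>\<^sub>0 real"
  let ?K = "Poly_Mapping.keys x \<union> Poly_Mapping.keys y"
  have "free_lift f (x + y) = (\<Sum>k\<in>?K. Poly_Mapping.lookup (x + y) k *\<^sub>R f k)"
    using Poly_Mapping.keys_add[of x y] by (intro free_lift_superset) auto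
  also have "\<dots> = free_lift f x + free_lift f y"
    by (subst (1 2) free_lift_superset[of ?K]) (auto simp: lookup_add algebra_simps sum.distrib)
  finally show "free_lift f (x + y) = free_lift f x + free_lift f y" .
next
  fix r :: real and x :: "'a \<Rightarrow>\<^sub>0 real"
  have "free_lift f (r *\<^sub>R x) =
      (\<Sum>k\<in>Poly_Mapping.keys x. Poly_Mapping.lookup (r *\<^sub>R x) k *\<^sub>R f k)"
    by (intro free_lift_superset) (auto simp: in_keys_iff)
  then show "free_lift f (r *\<^sub>R x) = r *\<^sub>R free_lift f x"
    by (simp add: free_lift_def scaleR_sum_right)
qed

lemma free_span: "x \<in> span (range (\<lambda>k. Poly_Mapping.single k (1::real)))"
proof -
  have "x = (\<Sum>k\<in>Poly_Mapping.keys x. Poly_Mapping.lookup x k *\<^sub>R Poly_Mapping.single k 1)"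
  proof (rule poly_mapping_eqI)
    fix k
    have *: "Poly_Mapping.lookup (sum g A) k = (\<Sum>a\<in>A. Poly_Mapping.lookup (g a) k)"
      for g :: "'a \<Rightarrow> ('a \<Rightarrow>\<^sub>0 real)" and A
      by (induction A rule: infinite_finite_induct) (auto simp: lookup_add)
    show "Poly_Mapping.lookup x k = Poly_Mapping.lookup (\<Sum>k\<in>Poly_Mapping.keys x.
        Poly_Mapping.lookup x k *\<^sub>R Poly_Mapping.single k 1) k"
      by (simp add: * lookup_single when_def in_keys_iff if_distrib[of "(*) _"] cong: if_cong)
  qed
  then show ?thesis
    by (metis (no_types, lifting) rangeI span_base span_scale span_sum)
qed

lemma equivp_mod_subspace: "subspace S \<Longrightarrow> equivp (\<lambda>x y. x - y \<in> S)"
proof (intro equivpI reflpI sympI transpI)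
  assume S: "subspace S"
  show "x - x \<in> S" for x
    using subspace_0[OF S] by simp
  show "y - x \<in> S" if "x - y \<in> S" for x y
    using subspace_neg[OF S that] by simp
  show "x - z \<in> S" if "x - y \<in> S" "y - z \<in> S" for x y z
    using subspace_add[OF S that] by simp
qed

lemma mod_subspace_cong:
  assumes "subspace S" "x - y \<in> S"
  shows "x' - y' \<in> S \<Longrightarrow> (x + x') - (y + y') \<in> S"
    "x' - y' \<in> S \<Longrightarrow> (x - x') - (y - y') \<in> S"
    "- x - - y \<in> S" "r *\<^sub>R x - r *\<^sub>R y \<in> S"
proof -
  show "(x + x') - (y + y') \<in> S" if "x' - y' \<in> S"
    using subspace_add[OF assms that] by (simp add: algebra_simps)
  show "(x - x') - (y - y') \<in> S" if "x' - y' \<in> S"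
    using subspace_diff[OF assms that] by (simp add: algebra_simps)
  show "- x - - y \<in> S"
    using subspace_neg[OF assms] by (simp add: algebra_simps)
  show "r *\<^sub>R x - r *\<^sub>R y \<in> S"
    using subspace_scale[OF assms, of r] by (simp add: algebra_simps)
qed

definition tensor_relations :: "('a::real_vector list \<Rightarrow>\<^sub>0 real) set" where
  "tensor_relations = span
    ({Poly_Mapping.single (u @ [a + b] @ v) 1 - Poly_Mapping.single (u @ [a] @ v) 1
        - Poly_Mapping.single (u @ [b] @ v) 1 | u v a b. True} \<union>
     {Poly_Mapping.single (u @ [r *\<^sub>R a] @ v) 1 - r *\<^sub>R Poly_Mapping.single (u @ [a] @ v) 1
        | u v r a. True})"

quotient_type (overloaded) 'a tensor = "'a::real_vector list \<Rightarrow>\<^sub>0 real"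
  / "\<lambda>x y. x - y \<in> tensor_relations"
  unfolding tensor_relations_def by (rule equivp_mod_subspace) simp

lemma subspace_tensor_relations: "subspace tensor_relations"
  by (simp add: tensor_relations_def)

lemma tensor_cases: obtains x' where "x = abs_tensor x'"
  using Quotient3_abs_rep[OF Quotient3_tensor] by metis

instantiation tensor :: (real_vector) real_vector
begin

lift_definition zero_tensor :: "'a tensor" is 0 .
lift_definition plus_tensor :: "'a tensor \<Rightarrow> 'a tensor \<Rightarrow> 'a tensor" is "(+)"
  by (rule mod_subspace_cong[OF subspace_tensor_relations])
lift_definition minus_tensor :: "'a tensor \<Rightarrow> 'a tensor \<Rightarrow> 'a tensor" is "(-)"
  by (rule mod_subspace_cong[OF subspace_tensor_relations])
lift_definition uminus_tensor :: "'a tensor \<Rightarrow> 'a tensor" is uminus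
  by (rule mod_subspace_cong[OF subspace_tensor_relations])
lift_definition scaleR_tensor :: "real \<Rightarrow> 'a tensor \<Rightarrow> 'a tensor" is "(*\<^sub>R)"
  by (rule mod_subspace_cong[OF subspace_tensor_relations])

instance
  by standard
    (transfer; simp add: scaleR_add_right scaleR_add_left add.assoc add.commute
      subspace_0[OF subspace_tensor_relations])+

end

lemma linear_abs_tensor: "linear abs_tensor"
  by (rule linearI) (simp_all add: plus_tensor.abs_eq scaleR_tensor.abs_eq)

text \<open>The elementary tensor \<open>a\<^sub>1 \<otimes> \<cdots> \<otimes> a\<^sub>n\<close>.\<close>

definition tens :: "'a::real_vector list \<Rightarrow> 'a tensor" where
  "tens xs = abs_tensor (Poly_Mapping.single xs 1)"

definition multilinear :: "('a::real_vector list \<Rightarrow> 'v::real_vector) \<Rightarrow> bool" where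
  "multilinear f \<longleftrightarrow> (\<forall>u v. linear (\<lambda>a. f (u @ [a] @ v)))"

text \<open>
  The linear map out of the tensor algebra with prescribed values on elementary tensors. It is
  evaluated on a representative, which is independent of the choice (and hence meaningful)
  when \<open>f\<close> is multilinear.
\<close>

definition tensor_lift :: "('a::real_vector list \<Rightarrow> 'v::real_vector) \<Rightarrow> 'a tensor \<Rightarrow> 'v" where
  "tensor_lift f x = free_lift f (rep_tensor x)"

lemma multilinear_tens: "multilinear tens"
  unfolding multilinear_def tens_def
proof (intro allI linearI)
  fix u v :: "'a list" and a b :: 'a and r :: real
  have "abs_tensor (Poly_Mapping.single (u @ [a + b] @ v) 1) =
     abs_tensor (Poly_Mapping.single (u @ [a] @ v) 1 + Poly_Mapping.single (u @ [b] @ v) 1)"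
    unfolding tensor.abs_eq_iff tensor_relations_def
    by (rule span_base, rule UnI1, simp only: diff_diff_eq [symmetric], blast)
  then show "abs_tensor (Poly_Mapping.single (u @ [a + b] @ v) 1) =
     abs_tensor (Poly_Mapping.single (u @ [a] @ v) 1) + abs_tensor (Poly_Mapping.single (u @ [b] @ v) 1)"
    by (simp add: plus_tensor.abs_eq)
  have "abs_tensor (Poly_Mapping.single (u @ [r *\<^sub>R a] @ v) 1) =
     abs_tensor (r *\<^sub>R Poly_Mapping.single (u @ [a] @ v) 1)"
    unfolding tensor.abs_eq_iff tensor_relations_def
    by (rule span_base, rule UnI2, blast)
  then show "abs_tensor (Poly_Mapping.single (u @ [r *\<^sub>R a] @ v) 1) =
     r *\<^sub>R abs_tensor (Poly_Mapping.single (u @ [a] @ v) 1)"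
    by (simp add: scaleR_tensor.abs_eq)
qed

lemma tensor_lift_abs:
  assumes "multilinear f"
  shows "tensor_lift f (abs_tensor x) = free_lift f x"
proof -
  interpret f: linear "free_lift f" by (rule linear_free_lift)
  have *: "free_lift f y = 0" if "y \<in> tensor_relations" for y
    using that unfolding tensor_relations_def
  proof (rule span_induct)
    show "subspace {y. free_lift f y = 0}"
      by (rule real_vector.subspaceI) (simp_all add: f.add f.scale)
  next
    fix y
    assume y: "y \<in>
    {Poly_Mapping.single (u @ [a + b] @ v) 1 - Poly_Mapping.single (u @ [a] @ v) 1
        - Poly_Mapping.single (u @ [b] @ v) (1::real) | u v (a::'a) b. True} \<union>
     {Poly_Mapping.single (u @ [r *\<^sub>R a] @ v) 1 - r *\<^sub>R Poly_Mapping.single (u @ [a] @ v) 1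
        | u v r a. True}"
    have lin: "linear (\<lambda>a. f (u @ [a] @ v))" for u v
      using assms by (auto simp: multilinear_def)
    show "free_lift f y = 0"
      using y
      by (elim UnE; clarify)
        (simp_all only: f.diff f.scale free_lift_single linear_add[OF lin] linear_scale[OF lin]
          scaleR_one, simp_all)
  qed
  have "rep_tensor (abs_tensor x) - x \<in> tensor_relations"
    by (simp add: tensor.abs_eq_iff[symmetric] Quotient3_abs_rep[OF Quotient3_tensor])
  from *[OF this] show ?thesis by (simp add: tensor_lift_def f.diff)
qed

lemma linear_tensor_lift:
  assumes "multilinear f"
  shows "linear (tensor_lift f)"
proof (rule linearI)
  interpret f: linear "free_lift f" by (rule linear_free_lift)
  fix x y :: "'a tensor" and r :: real
  obtain x' y' where [simp]: "x = abs_tensor x'" "y = abs_tensor y'"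
    by (metis tensor_cases)
  show "tensor_lift f (x + y) = tensor_lift f x + tensor_lift f y"
    by (simp add: tensor_lift_abs[OF assms] plus_tensor.abs_eq f.add)
  show "tensor_lift f (r *\<^sub>R x) = r *\<^sub>R tensor_lift f x"
    by (simp add: tensor_lift_abs[OF assms] scaleR_tensor.abs_eq f.scale)
qed

lemma tensor_lift_tens [simp]: "multilinear f \<Longrightarrow> tensor_lift f (tens xs) = f xs"
  by (simp add: tens_def tensor_lift_abs)

lemma tensor_span: "x \<in> span (range tens)"
proof -
  obtain x' where x: "x = abs_tensor x'"
    by (rule tensor_cases)
  have "x \<in> abs_tensor ` span (range (\<lambda>k. Poly_Mapping.single k 1))"
    using x free_span by blast
  also have "\<dots> = span (range tens)"
    by (subst linear_span_image[OF linear_abs_tensor, symmetric]) (simp add: image_image tens_def)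
  finally show ?thesis .
qed

lemma linear_eq_on_tens:
  assumes "linear f" "linear g" "\<And>xs. f (tens xs) = g (tens xs)"
  shows "f x = g x"
proof (rule linear_eq_on_span[OF assms(1,2) _ tensor_span])
  fix y :: "'a tensor" assume "y \<in> range tens"
  then obtain xs where "y = tens xs" by (rule rangeE)
  then show "f y = g y" using assms(3) by simp
qed

text \<open>Multilinearity of a composite \<open>a \<mapsto> g [\<dots>, h a, \<dots>]\<close> in which only one slot varies.\<close>

lemma linear_slot:
  assumes "multilinear g" "linear h" "p < N" "\<And>a. length (F a) = N" "\<And>a. F a ! p = h a"
    "\<And>a q. q < N \<Longrightarrow> q \<noteq> p \<Longrightarrow> F a ! q = F 0 ! q"
  shows "linear (\<lambda>a. g (F a))"
proof -
  have "F a = take p (F 0) @ [h a] @ drop (Suc p) (F 0)" for a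
  proof (rule nth_equalityI)
    show "length (F a) = length (take p (F 0) @ [h a] @ drop (Suc p) (F 0))"
      using assms(3) by (simp add: assms(4))
    fix q assume "q < length (F a)"
    then have q: "q < N" by (simp add: assms(4))
    consider "q < p" | "q = p" | "q > p" by linarith
    then show "F a ! q = (take p (F 0) @ [h a] @ drop (Suc p) (F 0)) ! q"
    proof cases
      case 1
      then show ?thesis using assms(3) assms(6)[of q a] q by (simp add: nth_append assms(4))
    next
      case 2
      then show ?thesis using assms(3) assms(5)[of a] by (simp add: nth_append assms(4))
    next
      case 3
      then show ?thesis using assms(3) assms(6)[of q a] q
        by (simp add: nth_append assms(4) min_def nth_Cons')
    qed
  qed
  then have "g (F a) = g (take p (F 0) @ [h a] @ drop (Suc p) (F 0))" for a
    by (rule arg_cong)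
  then have "(\<lambda>a. g (F a)) = (\<lambda>b. g (take p (F 0) @ [b] @ drop (Suc p) (F 0))) \<circ> h"
    by (simp add: fun_eq_iff)
  moreover have "linear (\<lambda>b. g (take p (F 0) @ [b] @ drop (Suc p) (F 0)))"
    using assms(1) by (auto simp: multilinear_def)
  ultimately show ?thesis using linear_compose[OF assms(2)] by simp
qed

lemma multilinearI_nth:
  assumes "\<And>xs k. k < length xs \<Longrightarrow> linear (\<lambda>a. f (xs[k := a]))"
  shows "multilinear f"
  unfolding multilinear_def
proof (intro allI)
  fix u v :: "'a list"
  have "linear (\<lambda>a. f ((u @ [0] @ v)[length u := a]))" by (rule assms) simp
  then show "linear (\<lambda>a. f (u @ [a] @ v))" by simp
qed

lemma multilinear_nthD:
  assumes "multilinear f" "k < length xs"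
  shows "linear (\<lambda>a. f (xs[k := a]))"
  using assms by (auto simp: multilinear_def upd_conv_take_nth_drop)

lemma multilinear_linear: "multilinear f \<Longrightarrow> linear g \<Longrightarrow> multilinear (\<lambda>xs. g (f xs))"
  unfolding multilinear_def using linear_compose[of _ g] by (fastforce simp: o_def)

instantiation tensor :: (real_vector) real_algebra_1
begin

definition one_tensor :: "'a tensor" where
  "1 = tens []"

text \<open>Multiplication is concatenation of elementary tensors; see \<open>tens_mult\<close> below.\<close>

definition times_tensor :: "'a tensor \<Rightarrow> 'a tensor \<Rightarrow> 'a tensor" where
  "x * y = tensor_lift (\<lambda>u. tensor_lift (\<lambda>v. tens (u @ v)) y) x"

lemma multilinear_tens_append: "multilinear (\<lambda>v. tens ((u :: 'a list) @ v))"
  unfolding multilinear_def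
proof (intro allI)
  fix p q :: "'a list"
  have "linear (\<lambda>a. tens ((u @ p) @ [a] @ q))"
    using multilinear_tens unfolding multilinear_def by blast
  then show "linear (\<lambda>a. tens (u @ p @ [a] @ q))" by simp
qed

lemma multilinear_append_lift:
  "multilinear (\<lambda>u. tensor_lift (\<lambda>v. tens (u @ v)) (y :: 'a tensor))"
  unfolding multilinear_def
proof (intro allI linearI)
  fix p q :: "'a list" and a b :: 'a and r :: real
  let ?G = "\<lambda>a. tensor_lift (\<lambda>v. tens ((p @ [a] @ q) @ v))"
  have G: "linear (?G a)" for a
    by (rule linear_tensor_lift[OF multilinear_tens_append])
  have lin: "linear (\<lambda>a. tens ((p @ [a] @ q) @ xs))" for xs
    using multilinear_tens unfolding multilinear_def append.assoc by blast
  show "?G (a + b) y = ?G a y + ?G b y"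
  proof (rule linear_eq_on_tens[of "?G (a + b)" "\<lambda>y. ?G a y + ?G b y"])
    show "?G (a + b) (tens xs) = ?G a (tens xs) + ?G b (tens xs)" for xs
      unfolding tensor_lift_tens[OF multilinear_tens_append] by (rule linear_add[OF lin])
  qed (intro linear_compose_add G)+
  show "?G (r *\<^sub>R a) y = r *\<^sub>R ?G a y"
  proof (rule linear_eq_on_tens[of "?G (r *\<^sub>R a)" "\<lambda>y. r *\<^sub>R ?G a y"])
    show "?G (r *\<^sub>R a) (tens xs) = r *\<^sub>R ?G a (tens xs)" for xs
      unfolding tensor_lift_tens[OF multilinear_tens_append] by (rule linear_scale[OF lin])
  qed (intro linear_compose_scale_right G)+
qed

lemma tens_mult: "tens u * tens v = tens (u @ v)"
  unfolding times_tensor_def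
  by (subst tensor_lift_tens[OF multilinear_append_lift])
    (rule tensor_lift_tens[OF multilinear_tens_append])

lemma linear_tensor_mult_right: "linear (\<lambda>x. x * (y :: 'a tensor))"
  unfolding times_tensor_def by (rule linear_tensor_lift[OF multilinear_append_lift])

lemma linear_tensor_mult_left: "linear (\<lambda>y. (x :: 'a tensor) * y)"
proof (rule linearI)
  fix y z :: "'a tensor" and r :: real
  have lin: "linear (\<lambda>y. tens xs * y)" for xs :: "'a list"
    unfolding times_tensor_def
    by (simp add: tensor_lift_tens[OF multilinear_append_lift]
        linear_tensor_lift[OF multilinear_tens_append])
  show "x * (y + z) = x * y + x * z"
    by (rule linear_eq_on_tens[of "\<lambda>x. x * (y + z)" "\<lambda>x. x * y + x * z"])
      (simp_all add: linear_tensor_mult_right linear_compose_add linear_add[OF lin])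
  show "x * (r *\<^sub>R y) = r *\<^sub>R (x * y)"
    by (rule linear_eq_on_tens[of "\<lambda>x. x * (r *\<^sub>R y)" "\<lambda>x. r *\<^sub>R (x * y)"])
      (simp_all add: linear_tensor_mult_right linear_compose_scale_right linear_scale[OF lin])
qed

lemma tens_Nil_neq_0: "tens [] \<noteq> (0 :: 'a tensor)"
proof -
  let ?f = "\<lambda>xs::'a list. if xs = [] then 1 else (0::real)"
  have f: "multilinear ?f"
    unfolding multilinear_def by (auto intro!: linearI)
  have "tensor_lift ?f (tens []) = 1" using f by simp
  moreover have "tensor_lift ?f 0 = 0" by (rule linear_0[OF linear_tensor_lift[OF f]])
  ultimately show ?thesis by (metis zero_neq_one)
qed

instance
proof
  fix a b c :: "'a tensor" and r :: real
  note R = linear_tensor_mult_right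
  note L = linear_tensor_mult_left
  show "(a + b) * c = a * c + b * c" by (rule linear_add[OF R])
  show "a * (b + c) = a * b + a * c" by (rule linear_add[OF L])
  show "r *\<^sub>R a * b = r *\<^sub>R (a * b)" by (rule linear_scale[OF R])
  show "a * r *\<^sub>R b = r *\<^sub>R (a * b)" by (rule linear_scale[OF L])
  show "1 * a = a"
    by (rule linear_eq_on_tens[of "\<lambda>a. 1 * a" "\<lambda>a. a"])
      (simp_all add: L one_tensor_def tens_mult linear_ident)
  show "a * 1 = a"
    by (rule linear_eq_on_tens[of "\<lambda>a. a * 1" "\<lambda>a. a"])
      (simp_all add: R one_tensor_def tens_mult linear_ident)
  show "(0::'a tensor) \<noteq> 1" using tens_Nil_neq_0 by (simp add: one_tensor_def)
  show "a * b * c = a * (b * c)"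
  proof (rule linear_eq_on_tens[of "\<lambda>a. a * b * c" "\<lambda>a. a * (b * c)"])
    show "linear (\<lambda>a. a * b * c)" using linear_compose[OF R R] by (simp add: o_def)
    show "linear (\<lambda>a. a * (b * c))" by (rule R)
    fix u :: "'a list"
    show "tens u * b * c = tens u * (b * c)"
    proof (rule linear_eq_on_tens[of "\<lambda>b. tens u * b * c" "\<lambda>b. tens u * (b * c)"])
      show "linear (\<lambda>b. tens u * b * c)" using linear_compose[OF L R] by (simp add: o_def)
      show "linear (\<lambda>b. tens u * (b * c))" using linear_compose[OF R L] by (simp add: o_def)
      fix v :: "'a list"
      show "tens u * tens v * c = tens u * (tens v * c)"
      proof (rule linear_eq_on_tens[of "\<lambda>c. tens u * tens v * c" "\<lambda>c. tens u * (tens v * c)"])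
        show "linear (\<lambda>c. tens u * tens v * c)" by (rule L)
        show "linear (\<lambda>c. tens u * (tens v * c))" using linear_compose[OF L L] by (simp add: o_def)
      qed (simp add: tens_mult)
    qed
  qed
qed

end

definition two_sided_ideal :: "'r::real_algebra_1 set \<Rightarrow> 'r set" where
  "two_sided_ideal R = span {u * r * v | u r v. r \<in> R}"

lemma subspace_two_sided_ideal: "subspace (two_sided_ideal R)"
  by (simp add: two_sided_ideal_def)

lemma two_sided_ideal_mult:
  assumes "x \<in> two_sided_ideal R"
  shows "a * x * b \<in> two_sided_ideal R"
  using assms unfolding two_sided_ideal_def
proof (rule span_induct)
  let ?S = "span {u * r * v | u r v. r \<in> R}"
  show "subspace {x. a * x * b \<in> ?S}"
    by (rule real_vector.subspaceI)
      (simp_all add: distrib_left distrib_right span_add span_scale span_zero)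
  fix x assume "x \<in> {u * r * v | u r v. r \<in> R}"
  then obtain u r v where x: "x = u * r * v" "r \<in> R" by blast
  have "a * x * b = (a * u) * r * (v * b)" using x by (simp add: mult.assoc)
  with x(2) show "a * x * b \<in> ?S" by (intro span_base) blast
qed


section \<open>Lie algebras and universal enveloping algebras\<close>

class real_lie_algebra = real_vector +
  fixes lie_bracket :: "'a \<Rightarrow> 'a \<Rightarrow> 'a"
  assumes lie_bracket_add_left: "lie_bracket (x + y) z = lie_bracket x z + lie_bracket y z"
    and lie_bracket_add_right: "lie_bracket x (y + z) = lie_bracket x y + lie_bracket x z"
    and lie_bracket_scaleR_left: "lie_bracket (r *\<^sub>R x) y = r *\<^sub>R lie_bracket x y"
    and lie_bracket_scaleR_right: "lie_bracket x (r *\<^sub>R y) = r *\<^sub>R lie_bracket x y"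
    and lie_bracket_self: "lie_bracket x x = 0"
    and lie_jacobi: "lie_bracket x (lie_bracket y z) + lie_bracket y (lie_bracket z x)
      + lie_bracket z (lie_bracket x y) = 0"

definition uea_ideal :: "'a::real_lie_algebra tensor set" where
  "uea_ideal = two_sided_ideal {tens [x, y] - tens [y, x] - tens [lie_bracket x y] | x y. True}"

lemma subspace_uea_ideal: "subspace uea_ideal"
  by (simp add: uea_ideal_def subspace_two_sided_ideal)

quotient_type (overloaded) 'a uea = "'a::real_lie_algebra tensor" / "\<lambda>x y. x - y \<in> uea_ideal"
  by (rule equivp_mod_subspace[OF subspace_uea_ideal])

lemma one_notin_uea_ideal: "(1 :: 'a::real_lie_algebra tensor) \<notin> uea_ideal"
proof
  let ?f = "\<lambda>xs::'a list. if xs = [] then 1 else (0::real)"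
  have f: "multilinear ?f"
    unfolding multilinear_def by (auto intro!: linearI)
  interpret f: linear "tensor_lift ?f" by (rule linear_tensor_lift[OF f])
  have mult: "tensor_lift ?f (a * b) = tensor_lift ?f a * tensor_lift ?f b" for a b
  proof (rule linear_eq_on_tens[of "\<lambda>a. tensor_lift ?f (a * b)"
        "\<lambda>a. tensor_lift ?f a * tensor_lift ?f b"])
    fix u :: "'a list"
    show "tensor_lift ?f (tens u * b) = tensor_lift ?f (tens u) * tensor_lift ?f b"
      by (rule linear_eq_on_tens[of "\<lambda>b. tensor_lift ?f (tens u * b)"
        "\<lambda>b. tensor_lift ?f (tens u) * tensor_lift ?f b"])
        (auto intro!: linearI simp: f tens_mult f.add f.scale algebra_simps)
  qed (auto intro!: linearI simp: f.add f.scale algebra_simps)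
  assume "(1 :: 'a tensor) \<in> uea_ideal"
  then have "tensor_lift ?f 1 = 0"
    unfolding uea_ideal_def two_sided_ideal_def
  proof (rule span_induct)
    show "subspace {x. tensor_lift ?f x = 0}"
      by (rule real_vector.subspaceI) (simp_all add: f.add f.scale)
  qed (auto simp: mult f f.diff)
  then show False by (simp add: one_tensor_def f)
qed

instantiation uea :: (real_lie_algebra) real_algebra_1
begin

lift_definition zero_uea :: "'a uea" is 0 .
lift_definition one_uea :: "'a uea" is 1 .
lift_definition plus_uea :: "'a uea \<Rightarrow> 'a uea \<Rightarrow> 'a uea" is "(+)"
  by (rule mod_subspace_cong[OF subspace_uea_ideal])
lift_definition minus_uea :: "'a uea \<Rightarrow> 'a uea \<Rightarrow> 'a uea" is "(-)"
  by (rule mod_subspace_cong[OF subspace_uea_ideal])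
lift_definition uminus_uea :: "'a uea \<Rightarrow> 'a uea" is uminus
  by (rule mod_subspace_cong[OF subspace_uea_ideal])
lift_definition scaleR_uea :: "real \<Rightarrow> 'a uea \<Rightarrow> 'a uea" is "(*\<^sub>R)"
  by (rule mod_subspace_cong[OF subspace_uea_ideal])
lift_definition times_uea :: "'a uea \<Rightarrow> 'a uea \<Rightarrow> 'a uea" is "(*)"
proof -
  fix x x' y y' :: "'a tensor"
  assume "x - x' \<in> uea_ideal" "y - y' \<in> uea_ideal"
  then have "1 * (x - x') * y + x' * (y - y') * 1 \<in> uea_ideal"
    unfolding uea_ideal_def by (intro subspace_add subspace_two_sided_ideal two_sided_ideal_mult)
  then show "x * y - x' * y' \<in> uea_ideal"
    by (simp add: algebra_simps)
qed

instance
proof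
  show "(0 :: 'a uea) \<noteq> 1"
    by transfer (metis diff_0 minus_minus one_notin_uea_ideal subspace_neg subspace_uea_ideal)
qed (transfer; simp add: scaleR_add_right scaleR_add_left distrib_left distrib_right mult.assoc
      add.assoc add.commute subspace_0[OF subspace_uea_ideal])+

end

text \<open>The canonical map from a Lie algebra to its universal enveloping algebra.\<close>

definition uea_incl :: "'a::real_lie_algebra \<Rightarrow> 'a uea" where
  "uea_incl x = abs_uea (tens [x])"

lemma linear_uea_incl: "linear uea_incl"
proof -
  have "linear (\<lambda>a. tens ([] @ [a] @ []))"
    using multilinear_tens unfolding multilinear_def by blast
  then have lin: "linear (\<lambda>a. tens [a])" by simp
  then show ?thesis
    by (intro linearI) (simp_all add: uea_incl_def linear_add[OF lin] linear_scale[OF lin]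
        plus_uea.abs_eq scaleR_uea.abs_eq)
qed

lemma uea_incl_bracket:
  "uea_incl (lie_bracket x y) = uea_incl x * uea_incl y - uea_incl y * uea_incl x"
proof -
  let ?r = "tens [x, y] - tens [y, x] - tens [lie_bracket x y]"
  have "1 * ?r * 1 \<in> uea_ideal"
    unfolding uea_ideal_def two_sided_ideal_def by (intro span_base) blast
  then have "abs_uea (tens [x, y] - tens [y, x]) = abs_uea (tens [lie_bracket x y])"
    by (simp add: uea.abs_eq_iff)
  then show ?thesis
    by (simp add: uea_incl_def times_uea.abs_eq tens_mult minus_uea.abs_eq)
qed

section \<open>Polynomial vector fields on the line\<close>

text \<open>\<open>Vector_Field f\<close> is the vector field \<open>f d/dx\<close>.\<close>

typedef poly_vector_field = "UNIV :: real poly set"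
  morphisms vf_coeff Vector_Field ..

setup_lifting type_definition_poly_vector_field

instantiation poly_vector_field :: real_lie_algebra
begin

lift_definition zero_poly_vector_field :: poly_vector_field is 0 .
lift_definition plus_poly_vector_field ::
  "poly_vector_field \<Rightarrow> poly_vector_field \<Rightarrow> poly_vector_field" is "(+)" .
lift_definition minus_poly_vector_field ::
  "poly_vector_field \<Rightarrow> poly_vector_field \<Rightarrow> poly_vector_field" is "(-)" .
lift_definition uminus_poly_vector_field ::
  "poly_vector_field \<Rightarrow> poly_vector_field" is uminus .
lift_definition scaleR_poly_vector_field ::
  "real \<Rightarrow> poly_vector_field \<Rightarrow> poly_vector_field" is smult .
lift_definition lie_bracket_poly_vector_field ::
  "poly_vector_field \<Rightarrow> poly_vector_field \<Rightarrow> poly_vector_field"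
  is "\<lambda>f g. f * pderiv g - g * pderiv f" .

instance
  by standard
    (transfer; simp add: algebra_simps pderiv_add pderiv_diff pderiv_smult pderiv_mult
      smult_add_left smult_add_right)+

end

lemma lie_bracket_monom:
  assumes "n + k \<ge> 1"
  shows "lie_bracket (Vector_Field (monom 1 n)) (Vector_Field (monom 1 k))
     = (real k - real n) *\<^sub>R Vector_Field (monom 1 (n + k - 1))"
proof -
  have "monom 1 n * pderiv (monom 1 k) - monom 1 k * pderiv (monom 1 n)
      = smult (real k - real n) (monom 1 (n + k - 1))"
    using assms
    by (cases n; cases k) (auto simp: pderiv_monom mult_monom smult_monom diff_monom minus_monom add.commute)
  then show ?thesis
    by (simp add: lie_bracket_poly_vector_field.abs_eq scaleR_poly_vector_field.abs_eq)
qed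

section \<open>Exterior algebra\<close>

definition exterior_ideal :: "'a::real_vector tensor set" where
  "exterior_ideal = two_sided_ideal {tens [a, a] | a. True}"

lemma subspace_exterior_ideal: "subspace exterior_ideal"
  by (simp add: exterior_ideal_def subspace_two_sided_ideal)

quotient_type (overloaded) 'a exterior = "'a::real_vector tensor"
  / "\<lambda>x y. x - y \<in> exterior_ideal"
  by (rule equivp_mod_subspace[OF subspace_exterior_ideal])

instantiation exterior :: (real_vector) real_vector
begin

lift_definition zero_exterior :: "'a exterior" is 0 .
lift_definition plus_exterior :: "'a exterior \<Rightarrow> 'a exterior \<Rightarrow> 'a exterior" is "(+)"
  by (rule mod_subspace_cong[OF subspace_exterior_ideal])
lift_definition minus_exterior :: "'a exterior \<Rightarrow> 'a exterior \<Rightarrow> 'a exterior" is "(-)"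
  by (rule mod_subspace_cong[OF subspace_exterior_ideal])
lift_definition uminus_exterior :: "'a exterior \<Rightarrow> 'a exterior" is uminus
  by (rule mod_subspace_cong[OF subspace_exterior_ideal])
lift_definition scaleR_exterior :: "real \<Rightarrow> 'a exterior \<Rightarrow> 'a exterior" is "(*\<^sub>R)"
  by (rule mod_subspace_cong[OF subspace_exterior_ideal])

instance
  by standard
    (transfer; simp add: scaleR_add_right scaleR_add_left add.assoc add.commute
      subspace_0[OF subspace_exterior_ideal])+

end

lemma linear_abs_exterior: "linear abs_exterior"
  by (rule linearI) (simp_all add: plus_exterior.abs_eq scaleR_exterior.abs_eq)

text \<open>\<open>wedge [a\<^sub>1, \<dots>, a\<^sub>n]\<close> is \<open>a\<^sub>1 \<and> \<cdots> \<and> a\<^sub>n\<close>.\<close>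

definition wedge :: "'a::real_vector list \<Rightarrow> 'a exterior" where
  "wedge xs = abs_exterior (tens xs)"

definition exterior_power :: "nat \<Rightarrow> 'a::real_vector exterior set" where
  "exterior_power n = span (wedge ` {xs. length xs = n})"

definition alternating :: "('a::real_vector list \<Rightarrow> 'v::real_vector) \<Rightarrow> bool" where
  "alternating f \<longleftrightarrow> multilinear f \<and> (\<forall>u a v. f (u @ [a, a] @ v) = 0)"

text \<open>
  The linear map out of the exterior algebra with prescribed values on elementary wedges,
  well defined when \<open>f\<close> is multilinear and alternating.
\<close>

definition exterior_lift ::
  "('a::real_vector list \<Rightarrow> 'v::real_vector) \<Rightarrow> 'a exterior \<Rightarrow> 'v" where
  "exterior_lift f x = tensor_lift f (rep_exterior x)"

lemma exterior_lift_abs: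
  assumes "alternating f"
  shows "exterior_lift f (abs_exterior x) = tensor_lift f x"
proof -
  have f: "multilinear f" using assms by (simp add: alternating_def)
  interpret f: linear "tensor_lift f" by (rule linear_tensor_lift[OF f])
  have gen: "tensor_lift f (x * tens [a, a] * y) = 0" for x y a
  proof (rule linear_eq_on_tens[of "\<lambda>x. tensor_lift f (x * tens [a, a] * y)" "\<lambda>x. 0"])
    show "linear (\<lambda>x. tensor_lift f (x * tens [a, a] * y))"
      by (rule linearI) (simp_all add: f.add f.scale distrib_right)
    show "linear (\<lambda>x::'a tensor. 0 :: 'b)" by (rule linear_zero)
    fix u
    show "tensor_lift f (tens u * tens [a, a] * y) = 0"
    proof (rule linear_eq_on_tens[of "\<lambda>y. tensor_lift f (tens u * tens [a, a] * y)" "\<lambda>y. 0"])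
      show "linear (\<lambda>y. tensor_lift f (tens u * tens [a, a] * y))"
        by (rule linearI) (simp_all add: f.add f.scale distrib_left)
      show "linear (\<lambda>x::'a tensor. 0 :: 'b)" by (rule linear_zero)
      fix v
      show "tensor_lift f (tens u * tens [a, a] * tens v) = 0"
        using assms by (simp add: alternating_def tens_mult)
    qed
  qed
  have *: "tensor_lift f y = 0" if "y \<in> exterior_ideal" for y
    using that unfolding exterior_ideal_def two_sided_ideal_def
  proof (rule span_induct)
    show "subspace {y. tensor_lift f y = 0}"
      by (rule real_vector.subspaceI) (simp_all add: f.add f.scale)
  qed (use gen in blast)
  have "rep_exterior (abs_exterior x) - x \<in> exterior_ideal"
    by (simp add: exterior.abs_eq_iff[symmetric] Quotient3_abs_rep[OF Quotient3_exterior])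
  from *[OF this] show ?thesis by (simp add: exterior_lift_def f.diff)
qed

lemma exterior_lift_wedge: "alternating f \<Longrightarrow> exterior_lift f (wedge xs) = f xs"
  by (simp add: wedge_def exterior_lift_abs) (simp add: alternating_def)

lemma exterior_cases: obtains x' where "x = abs_exterior x'"
  using Quotient3_abs_rep[OF Quotient3_exterior] by metis

lemma linear_exterior_lift:
  assumes "alternating f"
  shows "linear (exterior_lift f)"
proof (rule linearI)
  interpret f: linear "tensor_lift f"
    by (rule linear_tensor_lift) (use assms in \<open>simp add: alternating_def\<close>)
  fix x y :: "'a exterior" and r :: real
  obtain x' y' where [simp]: "x = abs_exterior x'" "y = abs_exterior y'"
    by (metis exterior_cases)
  show "exterior_lift f (x + y) = exterior_lift f x + exterior_lift f y"
    by (simp add: exterior_lift_abs[OF assms] plus_exterior.abs_eq f.add)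
  show "exterior_lift f (r *\<^sub>R x) = r *\<^sub>R exterior_lift f x"
    by (simp add: exterior_lift_abs[OF assms] scaleR_exterior.abs_eq f.scale)
qed

lemma alternating_nth:
  assumes "alternating f" "Suc p < length xs" "xs ! p = xs ! Suc p"
  shows "f xs = 0"
proof -
  have "xs = take p xs @ [xs ! p, xs ! p] @ drop (Suc (Suc p)) xs"
    using assms(2,3) by (metis Cons_nth_drop_Suc Suc_lessD append_Cons append_Nil append_take_drop_id)
  then show ?thesis using assms(1) unfolding alternating_def by metis
qed

lemma alternating_swap:
  assumes "alternating f"
  shows "f (u @ [a, b] @ v) = - f (u @ [b, a] @ v)"
proof -
  have alt: "f (u @ [x, x] @ v) = 0" for x
    using assms by (simp add: alternating_def)
  have l: "linear (\<lambda>x. f (u @ [x] @ ([y] @ v)))" for y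
    using assms unfolding alternating_def multilinear_def by blast
  have r: "linear (\<lambda>y. f ((u @ [x]) @ [y] @ v))" for x
    using assms unfolding alternating_def multilinear_def by blast
  have "0 = f (u @ [a + b, a + b] @ v)" by (simp only: alt)
  also have "\<dots> = f (u @ [a, a + b] @ v) + f (u @ [b, a + b] @ v)"
    using linear_add[OF l[of "a + b"], of a b] by simp
  also have "\<dots> = f (u @ [a, a] @ v) + f (u @ [a, b] @ v) + (f (u @ [b, a] @ v) + f (u @ [b, b] @ v))"
    using linear_add[OF r[of a], of a b] linear_add[OF r[of b], of a b] by simp
  finally show ?thesis by (simp only: alt) (simp add: eq_neg_iff_add_eq_0)
qed

lemma alternating_linear: "alternating f \<Longrightarrow> linear g \<Longrightarrow> alternating (\<lambda>xs. g (f xs))"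
  by (auto simp: alternating_def multilinear_linear linear_0)

lemma alternating_wedge: "alternating wedge"
  unfolding alternating_def
proof (intro conjI allI)
  show "multilinear wedge"
    unfolding wedge_def by (rule multilinear_linear[OF multilinear_tens linear_abs_exterior])
  fix u v :: "'a list" and a
  have "tens u * tens [a, a] * tens v \<in> exterior_ideal"
    unfolding exterior_ideal_def two_sided_ideal_def by (rule span_base) blast
  then have "abs_exterior (tens (u @ [a, a] @ v)) = abs_exterior 0"
    unfolding exterior.abs_eq_iff by (simp add: tens_mult)
  then show "wedge (u @ [a, a] @ v) = 0"
    by (simp add: wedge_def zero_exterior.abs_eq)
qed

lemma multilinear_wedge: "multilinear wedge"
  using alternating_wedge unfolding alternating_def by (rule conjunct1)

definition exterior_map ::
  "('a::real_vector \<Rightarrow> 'b::real_vector) \<Rightarrow> 'a exterior \<Rightarrow> 'b exterior" where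
  "exterior_map f = exterior_lift (\<lambda>xs. wedge (map f xs))"

lemma exterior_map_wedge:
  assumes "linear f"
  shows "exterior_map f (wedge xs) = wedge (map f xs)"
  unfolding exterior_map_def
proof (rule exterior_lift_wedge)
  show "alternating (\<lambda>xs. wedge (map f xs))"
    unfolding alternating_def
  proof (intro conjI allI)
    show "multilinear (\<lambda>xs. wedge (map f xs))"
      unfolding multilinear_def
    proof (intro allI)
      fix u v
      have "linear (\<lambda>a. wedge (map f u @ [a] @ map f v))"
        using multilinear_wedge unfolding multilinear_def by blast
      from linear_compose[OF assms this] show "linear (\<lambda>a. wedge (map f (u @ [a] @ v)))"
        by (simp add: o_def)
    qed
    have "wedge (map f u @ [f a, f a] @ map f v) = 0" for u a v
      using alternating_wedge unfolding alternating_def by blast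
    then show "wedge (map f (u @ [a, a] @ v)) = 0" for u a v
      by simp
  qed
qed


section \<open>Lie algebra homology\<close>

text \<open>
  The \<open>(i, j)\<close> term replaces \<open>g\<^sub>i\<close> by \<open>[g\<^sub>i, g\<^sub>j]\<close> and deletes \<open>g\<^sub>j\<close>. List positions start at 0
  whereas the factors of \<open>g\<^sub>1 \<and> \<cdots> \<and> g\<^sub>n\<close> are counted from 1, so the sign \<open>(-1)\<^sup>j\<close> becomes
  \<open>(-1) ^ Suc j\<close>. The bracket is a parameter so that an associative algebra can be used with its
  commutator bracket.
\<close>

definition lie_d_list ::
  "('a::real_vector \<Rightarrow> 'a \<Rightarrow> 'a) \<Rightarrow> 'a list \<Rightarrow> 'a exterior" where
  "lie_d_list br xs = (\<Sum>j<length xs. \<Sum>i<j. (-1) ^ Suc j *\<^sub>R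
     wedge (let ys = xs[i := br (xs ! i) (xs ! j)] in take j ys @ drop (Suc j) ys))"

definition lie_d :: "('a::real_vector \<Rightarrow> 'a \<Rightarrow> 'a) \<Rightarrow> 'a exterior \<Rightarrow> 'a exterior" where
  "lie_d br = exterior_lift (lie_d_list br)"

lemma multilinear_lie_d_list:
  assumes l: "\<And>y. linear (\<lambda>x. br x y)" and r: "\<And>x. linear (br x)"
  shows "multilinear (lie_d_list br)"
proof (rule multilinearI_nth)
  fix xs :: "'a list" and k
  assume k: "k < length xs"
  note w = multilinear_wedge
  let ?F = "\<lambda>i j a. let ys = (xs[k := a])[i := br (xs[k := a] ! i) (xs[k := a] ! j)]
     in take j ys @ drop (Suc j) ys"
  have nth: "?F i j a ! q = (xs[k := a])[i := br (xs[k := a] ! i) (xs[k := a] ! j)]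
      ! (if q < j then q else Suc q)" if "i < j" "j < length xs" for i j a q
    using that by (auto simp: Let_def nth_append min_def)
  have lin: "linear (\<lambda>a. wedge (?F i j a))" if ij: "i < j" "j < length xs" for i j
  proof -
    have len: "length (?F i j a) = length xs - 1" for a using ij by (simp add: Let_def)
    consider "k = i" | "k = j" | "k < j" "k \<noteq> i" | "k > j" by linarith
    then show ?thesis
    proof cases
      case 1
      show ?thesis
        by (rule linear_slot[OF w l[of "xs ! j"], of i "length xs - 1"])
          (use 1 ij k len nth[OF ij] in \<open>auto simp: nth_list_update\<close>)
    next
      case 2
      show ?thesis
        by (rule linear_slot[OF w r[of "xs ! i"], of i "length xs - 1"])
          (use 2 ij k len nth[OF ij] in \<open>auto simp: nth_list_update\<close>)
    next
      case 3
      show ?thesis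
        by (rule linear_slot[OF w linear_ident, of k "length xs - 1"])
          (use 3 ij k len nth[OF ij] in \<open>auto simp: nth_list_update\<close>)
    next
      case 4
      show ?thesis
        by (rule linear_slot[OF w linear_ident, of "k - 1" "length xs - 1"])
          (use 4 ij k len nth[OF ij] in \<open>auto simp: nth_list_update\<close>)
    qed
  qed
  have "linear (\<lambda>a. \<Sum>j<length xs. \<Sum>i<j. (-1) ^ Suc j *\<^sub>R wedge (?F i j a))"
    by (intro linear_compose_sum ballI linear_compose_scale_right lin) auto
  then show "linear (\<lambda>a. lie_d_list br (xs[k := a]))"
    by (simp add: lie_d_list_def)
qed

lemma alternating_lie_d_list:
  assumes l: "\<And>y. linear (\<lambda>x. br x y)" and r: "\<And>x. linear (br x)" and self: "\<And>x. br x x = 0"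
  shows "alternating (lie_d_list br)"
  unfolding alternating_def
proof (intro conjI allI)
  show "multilinear (lie_d_list br)" by (rule multilinear_lie_d_list[OF l r])
  fix u v :: "'a list" and a
  define xs where "xs = u @ [a, a] @ v"
  define k where "k = length u"
  define L where "L i j = (let ys = xs[i := br (xs ! i) (xs ! j)] in take j ys @ drop (Suc j) ys)" for i j
  define T where "T i j = (-1) ^ Suc j *\<^sub>R wedge (L i j)" for i j
  define I where "I j = (\<Sum>i<j. T i j)" for j
  have N: "Suc k < length xs" by (simp add: xs_def k_def)
  have xk: "xs ! k = a" "xs ! Suc k = a" by (simp_all add: xs_def k_def nth_append)
  have nth: "L i j ! q = xs[i := br (xs ! i) (xs ! j)] ! (if q < j then q else Suc q)"
    if "i < j" "j < length xs" for i j q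
    using that by (auto simp: L_def Let_def nth_append min_def)
  have len: "length (L i j) = length xs - 1" if "i < j" "j < length xs" for i j
    using that by (simp add: L_def Let_def)
  have zero1: "T i j = 0" if ij: "i < j" "j < length xs" and no: "i \<noteq> k" "i \<noteq> Suc k" "j \<noteq> k" "j \<noteq> Suc k" for i j
  proof -
    have "wedge (L i j) = 0"
    proof (cases "j < k")
      case True
      show ?thesis
        by (rule alternating_nth[OF alternating_wedge, of "k - 1"])
          (use True ij no N in \<open>auto simp: len nth nth_list_update xk\<close>)
    next
      case False
      show ?thesis
        by (rule alternating_nth[OF alternating_wedge, of k])
          (use False ij no N in \<open>auto simp: len nth nth_list_update xk\<close>)
    qed
    then show ?thesis by (simp add: T_def)
  qed
  have zero2: "T k (Suc k) = 0"
  proof -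
    have "L k (Suc k) = u @ [0] @ v"
      by (simp add: L_def self xk Let_def) (simp add: xs_def k_def)
    moreover have "wedge (u @ [0] @ v) = 0"
      using alternating_wedge linear_0 unfolding alternating_def multilinear_def by blast
    ultimately show ?thesis by (simp add: T_def)
  qed
  have opp: "T i (Suc k) = - T i k" if "i < k" for i
  proof -
    have "L i (Suc k) = L i k"
      by (rule nth_equalityI) (use that N in \<open>auto simp: len nth nth_list_update xk less_Suc_eq\<close>)
    then show ?thesis by (simp add: T_def)
  qed
  have canc: "T k j + T (Suc k) j = 0" if j: "Suc k < j" "j < length xs" for j
  proof -
    define w1 g w2 where "w1 = take (j - k - 2) v" and "g = v ! (j - k - 2)"
      and "w2 = drop (Suc (j - k - 2)) v"
    have m: "j - k - 2 < length v" using j by (simp add: xs_def k_def)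
    have v: "v = w1 @ g # w2"
      unfolding w1_def g_def w2_def using id_take_nth_drop[OF m] .
    have jk: "j = length u + Suc (Suc (length w1))" using j m by (simp add: k_def w1_def)
    have g: "xs ! j = g" by (simp add: xs_def v jk nth_append)
    have "L k j = u @ [br a g, a] @ w1 @ w2"
      unfolding L_def xk g Let_def by (simp add: xs_def v jk k_def list_update_append numeral_3_eq_3)
    moreover have "L (Suc k) j = u @ [a, br a g] @ w1 @ w2"
      unfolding L_def xk g Let_def by (simp add: xs_def v jk k_def list_update_append numeral_3_eq_3)
    ultimately show ?thesis
      using alternating_swap[OF alternating_wedge, of u "br a g" a "w1 @ w2"] by (simp add: T_def)
  qed
  have "I j = 0" if "j < length xs" "j \<noteq> k" "j \<noteq> Suc k" for j
  proof (cases "j < k")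
    case True
    then show ?thesis unfolding I_def by (intro sum.neutral ballI zero1) (use that in auto)
  next
    case False
    then have j: "Suc k < j" using that by linarith
    have "I j = (\<Sum>i\<in>{k, Suc k}. T i j)"
      unfolding I_def by (intro sum.mono_neutral_right) (use j that zero1 in auto)
    then show ?thesis using canc[OF j] that by simp
  qed
  then have "(\<Sum>j<length xs. I j) = (\<Sum>j\<in>{k, Suc k}. I j)"
    by (intro sum.mono_neutral_right) (use N in auto)
  also have "\<dots> = I k + I (Suc k)" by simp
  also have "I (Suc k) = - I k"
    by (simp add: I_def zero2 sum_negf[symmetric] opp)
  finally show "lie_d_list br (u @ [a, a] @ v) = 0"
    by (simp add: lie_d_list_def I_def T_def L_def xs_def)
qed

lemma lie_d_wedge:
  assumes "\<And>y. linear (\<lambda>x. br x y)" "\<And>x. linear (br x)" "\<And>x. br x x = 0"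
  shows "lie_d br (wedge xs) = lie_d_list br xs"
  unfolding lie_d_def by (rule exterior_lift_wedge[OF alternating_lie_d_list[OF assms]])

text \<open>
  Homology of a complex with chain spaces \<open>C n\<close> and boundary \<open>d : C (Suc n) \<rightarrow> C n\<close>, as the set of
  classes of cycles modulo boundaries, and the map on classes induced by a chain map \<open>f\<close> into a
  complex \<open>C', d'\<close>.
\<close>

definition cycles :: "(nat \<Rightarrow> 'v::real_vector set) \<Rightarrow> ('v \<Rightarrow> 'v) \<Rightarrow> nat \<Rightarrow> 'v set" where
  "cycles C d n = {z \<in> C n. d z = 0}"

definition homologous :: "(nat \<Rightarrow> 'v::real_vector set) \<Rightarrow> ('v \<Rightarrow> 'v) \<Rightarrow> nat \<Rightarrow> ('v \<times> 'v) set" where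
  "homologous C d n =
     {(x, y). x \<in> cycles C d n \<and> y \<in> cycles C d n \<and> x - y \<in> d ` C (Suc n)}"

definition homology :: "(nat \<Rightarrow> 'v::real_vector set) \<Rightarrow> ('v \<Rightarrow> 'v) \<Rightarrow> nat \<Rightarrow> 'v set set" where
  "homology C d n = cycles C d n // homologous C d n"

definition induced_map ::
  "(nat \<Rightarrow> 'w::real_vector set) \<Rightarrow> ('w \<Rightarrow> 'w) \<Rightarrow> nat \<Rightarrow> ('v \<Rightarrow> 'w) \<Rightarrow> 'v set \<Rightarrow> 'w set" where
  "induced_map C' d' n f c = (\<Union>z\<in>c. homologous C' d' n `` {f z})"

definition lie_homology ::
  "('a::real_vector \<Rightarrow> 'a \<Rightarrow> 'a) \<Rightarrow> nat \<Rightarrow> 'a exterior set set" where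
  "lie_homology br n = homology exterior_power (lie_d br) n"

text \<open>The map induced on homology by a homomorphism into a Lie algebra with bracket \<open>br\<close>.\<close>

definition lie_homology_map ::
  "('b::real_vector \<Rightarrow> 'b \<Rightarrow> 'b) \<Rightarrow> ('a::real_vector \<Rightarrow> 'b) \<Rightarrow> nat
     \<Rightarrow> 'a exterior set \<Rightarrow> 'b exterior set" where
  "lie_homology_map br f n = induced_map exterior_power (lie_d br) n (exterior_map f)"


section \<open>Cyclic homology\<close>

definition cyclic_t_list :: "'a::real_vector list \<Rightarrow> 'a tensor" where
  "cyclic_t_list xs = (if xs = [] then tens []
     else (-1) ^ (length xs - 1) *\<^sub>R tens (last xs # butlast xs))"

definition cyclic_t :: "'a::real_vector tensor \<Rightarrow> 'a tensor" where
  "cyclic_t = tensor_lift cyclic_t_list"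

lemma nth_rotate_right:
  assumes "xs \<noteq> []" "q < length xs"
  shows "(last xs # butlast xs) ! q = (if q = 0 then xs ! (length xs - 1) else xs ! (q - 1))"
  using assms by (auto simp: nth_Cons' last_conv_nth nth_butlast)

lemma multilinear_cyclic_t_list: "multilinear cyclic_t_list"
proof (rule multilinearI_nth)
  fix xs :: "'a list" and k
  assume k: "k < length xs"
  then have ne: "xs \<noteq> []" by auto
  define F where "F a = last (xs[k := a]) # butlast (xs[k := a])" for a
  have nth: "F a ! q =
      (if q = 0 then xs[k := a] ! (length xs - 1) else xs[k := a] ! (q - 1))"
    if "q < length xs" for a q
    using nth_rotate_right[of "xs[k := a]" q] that ne by (simp add: F_def)
  have len: "length (F a) = length xs" for a
    using k by (simp add: F_def)
  have "linear (\<lambda>a. tens (F a))"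
    by (rule linear_slot[OF multilinear_tens linear_ident,
          of "if k = length xs - 1 then 0 else Suc k" "length xs"])
      (use k ne in \<open>auto simp: len nth nth_list_update split: if_splits\<close>)
  then show "linear (\<lambda>a. cyclic_t_list (xs[k := a]))"
    using ne by (simp add: cyclic_t_list_def F_def linear_compose_scale_right)
qed

lemma linear_cyclic_t: "linear cyclic_t"
  unfolding cyclic_t_def by (rule linear_tensor_lift[OF multilinear_cyclic_t_list])

lemma cyclic_t_tens:
  "xs \<noteq> [] \<Longrightarrow> cyclic_t (tens xs) = (-1) ^ (length xs - 1) *\<^sub>R tens (last xs # butlast xs)"
  by (simp add: cyclic_t_def tensor_lift_tens[OF multilinear_cyclic_t_list] cyclic_t_list_def)

definition cyclic_relations :: "'a::real_vector tensor set" where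
  "cyclic_relations = range (\<lambda>x. x - cyclic_t x)"

lemma linear_one_minus_t: "linear (\<lambda>x. x - cyclic_t x)"
  by (intro linear_compose_sub linear_ident linear_cyclic_t)

lemma subspace_cyclic_relations: "subspace cyclic_relations"
  unfolding cyclic_relations_def
  by (rule linear_subspace_image[OF linear_one_minus_t subspace_UNIV])

quotient_type (overloaded) 'a cyclic_tensor = "'a::real_vector tensor"
  / "\<lambda>x y. x - y \<in> cyclic_relations"
  by (rule equivp_mod_subspace[OF subspace_cyclic_relations])

instantiation cyclic_tensor :: (real_vector) real_vector
begin

lift_definition zero_cyclic_tensor :: "'a cyclic_tensor" is 0 .
lift_definition plus_cyclic_tensor ::
  "'a cyclic_tensor \<Rightarrow> 'a cyclic_tensor \<Rightarrow> 'a cyclic_tensor" is "(+)"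
  by (rule mod_subspace_cong[OF subspace_cyclic_relations])
lift_definition minus_cyclic_tensor ::
  "'a cyclic_tensor \<Rightarrow> 'a cyclic_tensor \<Rightarrow> 'a cyclic_tensor" is "(-)"
  by (rule mod_subspace_cong[OF subspace_cyclic_relations])
lift_definition uminus_cyclic_tensor :: "'a cyclic_tensor \<Rightarrow> 'a cyclic_tensor" is uminus
  by (rule mod_subspace_cong[OF subspace_cyclic_relations])
lift_definition scaleR_cyclic_tensor ::
  "real \<Rightarrow> 'a cyclic_tensor \<Rightarrow> 'a cyclic_tensor" is "(*\<^sub>R)"
  by (rule mod_subspace_cong[OF subspace_cyclic_relations])

instance
  by standard
    (transfer; simp add: scaleR_add_right scaleR_add_left add.assoc add.commute
      subspace_0[OF subspace_cyclic_relations])+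

end

lemma linear_abs_cyclic: "linear abs_cyclic_tensor"
  by (rule linearI) (simp_all add: plus_cyclic_tensor.abs_eq scaleR_cyclic_tensor.abs_eq)

definition cyc :: "'a::real_vector list \<Rightarrow> 'a cyclic_tensor" where
  "cyc xs = abs_cyclic_tensor (tens xs)"

lemma multilinear_cyc: "multilinear cyc"
  unfolding cyc_def by (rule multilinear_linear[OF multilinear_tens linear_abs_cyclic])

lemma cyc_rotate:
  assumes "xs \<noteq> []"
  shows "cyc xs = (-1) ^ (length xs - 1) *\<^sub>R cyc (last xs # butlast xs)"
proof -
  have "abs_cyclic_tensor (tens xs) = abs_cyclic_tensor (cyclic_t (tens xs))"
    unfolding cyclic_tensor.abs_eq_iff cyclic_relations_def by blast
  then show ?thesis
    using assms by (simp add: cyc_def cyclic_t_tens scaleR_cyclic_tensor.abs_eq)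
qed

definition cyclic_chains :: "nat \<Rightarrow> 'a::real_vector cyclic_tensor set" where
  "cyclic_chains n = span (cyc ` {xs. length xs = Suc n})"

text \<open>The Hochschild boundary; it vanishes in degree 0, i.e. on tensors of length 1.\<close>

definition hochschild_b_list :: "'a::real_algebra list \<Rightarrow> 'a tensor" where
  "hochschild_b_list xs = (if length xs \<le> 1 then 0
     else (\<Sum>i<length xs - 1. (-1) ^ i *\<^sub>R tens (take i xs @ [xs ! i * xs ! Suc i] @ drop (i + 2) xs))
       + (-1) ^ (length xs - 1) *\<^sub>R tens ((last xs * hd xs) # butlast (tl xs)))"

definition hochschild_b :: "'a::real_algebra tensor \<Rightarrow> 'a tensor" where
  "hochschild_b = tensor_lift hochschild_b_list"

lemma linear_mult_left: "linear (\<lambda>x. x * (y :: 'a::real_algebra))"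
  by (rule linearI) (simp_all add: distrib_right)

lemma linear_mult_right: "linear (\<lambda>y. (x :: 'a::real_algebra) * y)"
  by (rule linearI) (simp_all add: distrib_left)

lemma multilinear_hochschild_b_list: "multilinear hochschild_b_list"
proof (rule multilinearI_nth)
  fix xs :: "'a list" and k
  assume k: "k < length xs"
  show "linear (\<lambda>a. hochschild_b_list (xs[k := a]))"
  proof (cases "length xs \<le> 1")
    case True
    then show ?thesis by (simp add: hochschild_b_list_def linear_zero)
  next
    case False
    let ?M = "length xs - 1"
    define F where "F i a = take i (xs[k := a]) @ [xs[k := a] ! i * xs[k := a] ! Suc i]
      @ drop (i + 2) (xs[k := a])" for i a
    define E where "E a = (last (xs[k := a]) * hd (xs[k := a])) # butlast (tl (xs[k := a]))" for a
    have "linear (\<lambda>a. tens (F i a))" if i: "i < ?M" for i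
    proof -
      have nth: "F i a ! q = (if q < i then xs[k := a] ! q
          else if q = i then xs[k := a] ! i * xs[k := a] ! Suc i else xs[k := a] ! Suc q)"
        if "q < ?M" for a q
        using that i by (auto simp: F_def nth_append min_def nth_Cons')
      have len: "length (F i a) = ?M" for a using i by (simp add: F_def)
      consider "k = i" | "k = Suc i" | "k < i" | "k > Suc i" by linarith
      then show ?thesis
      proof cases
        case 1
        show ?thesis
          by (rule linear_slot[OF multilinear_tens linear_mult_left[of "xs ! Suc i"], of i ?M])
            (use 1 i k len nth in \<open>auto simp: nth_list_update\<close>)
      next
        case 2
        show ?thesis
          by (rule linear_slot[OF multilinear_tens linear_mult_right[of "xs ! i"], of i ?M])
            (use 2 i k len nth in \<open>auto simp: nth_list_update\<close>)
      next
        case 3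
        show ?thesis
          by (rule linear_slot[OF multilinear_tens linear_ident, of k ?M])
            (use 3 i k len nth in \<open>auto simp: nth_list_update\<close>)
      next
        case 4
        show ?thesis
          by (rule linear_slot[OF multilinear_tens linear_ident, of "k - 1" ?M])
            (use 4 i k len nth in \<open>auto simp: nth_list_update\<close>)
      qed
    qed
    moreover have "linear (\<lambda>a. tens (E a))"
    proof -
      have ne: "xs[k := a] \<noteq> []" for a using False by auto
      have nth: "E a ! q = (if q = 0 then xs[k := a] ! ?M * xs[k := a] ! 0 else xs[k := a] ! q)"
        if "q < ?M" for a q
        using that False ne[of a]
        by (auto simp: E_def nth_Cons' last_conv_nth hd_conv_nth nth_butlast nth_tl)
      have len: "length (E a) = ?M" for a using False by (simp add: E_def)
      consider "k = 0" | "k = ?M" "k \<noteq> 0" | "k \<noteq> 0" "k < ?M" using k by linarith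
      then show ?thesis
      proof cases
        case 1
        show ?thesis
          by (rule linear_slot[OF multilinear_tens linear_mult_right[of "xs ! ?M"], of 0 ?M])
            (use 1 False k len nth in \<open>auto simp: nth_list_update\<close>)
      next
        case 2
        show ?thesis
          by (rule linear_slot[OF multilinear_tens linear_mult_left[of "xs ! 0"], of 0 ?M])
            (use 2 False k len nth in \<open>auto simp: nth_list_update\<close>)
      next
        case 3
        show ?thesis
          by (rule linear_slot[OF multilinear_tens linear_ident, of k ?M])
            (use 3 False k len nth in \<open>auto simp: nth_list_update\<close>)
      qed
    qed
    ultimately have "linear (\<lambda>a. (\<Sum>i<?M. (-1) ^ i *\<^sub>R tens (F i a)) + (-1) ^ ?M *\<^sub>R tens (E a))"
      by (intro linear_compose_add linear_compose_sum ballI linear_compose_scale_right) auto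
    then show ?thesis using False by (simp add: hochschild_b_list_def F_def E_def)
  qed
qed

lemma linear_hochschild_b: "linear hochschild_b"
  unfolding hochschild_b_def by (rule linear_tensor_lift[OF multilinear_hochschild_b_list])

lemma hochschild_b_tens: "hochschild_b (tens xs) = hochschild_b_list xs"
  by (simp add: hochschild_b_def tensor_lift_tens[OF multilinear_hochschild_b_list])

lemma hochschild_b_cyclic_relations:
  assumes "x \<in> cyclic_relations"
  shows "hochschild_b x \<in> cyclic_relations"
proof -
  interpret b: linear hochschild_b by (rule linear_hochschild_b)
  interpret q: linear abs_cyclic_tensor by (rule linear_abs_cyclic)
  have "abs_cyclic_tensor (hochschild_b y) = abs_cyclic_tensor (hochschild_b (cyclic_t y))"
    for y :: "'a tensor"
  proof (rule linear_eq_on_tens[of "\<lambda>y. abs_cyclic_tensor (hochschild_b y)"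
        "\<lambda>y. abs_cyclic_tensor (hochschild_b (cyclic_t y))"])
    show "linear (\<lambda>y::'a tensor. abs_cyclic_tensor (hochschild_b y))"
      using linear_compose[OF linear_hochschild_b linear_abs_cyclic] by (simp add: o_def)
    from linear_compose[OF linear_cyclic_t this]
    show "linear (\<lambda>y::'a tensor. abs_cyclic_tensor (hochschild_b (cyclic_t y)))"
      by (simp add: o_def)
    fix xs :: "'a list"
    show "abs_cyclic_tensor (hochschild_b (tens xs)) = abs_cyclic_tensor (hochschild_b (cyclic_t (tens xs)))"
    proof (cases "length xs \<le> 1")
      case True
      then consider "xs = []" | a where "xs = [a]" by (cases xs) auto
      then show ?thesis
      proof cases
        case 1
        then show ?thesis
          by (simp add: cyclic_t_def tensor_lift_tens[OF multilinear_cyclic_t_list] cyclic_t_list_def)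
      qed (simp add: cyclic_t_tens)
    next
      case False
      define n where "n = length xs - 2"
      have N: "length xs = Suc (Suc n)" using False by (simp add: n_def)
      define ys where "ys = last xs # butlast xs"
      have Ny: "length ys = Suc (Suc n)" using N by (simp add: ys_def)
      define D where "D zs i = take i zs @ [zs ! i * zs ! Suc i] @ drop (i + 2) zs" for zs :: "'a list" and i
      define E where "E zs = (last zs * hd zs) # butlast (tl zs)" for zs :: "'a list"
      have ne: "xs \<noteq> []" using N by auto
      have ynth: "ys ! q = (if q = 0 then xs ! Suc n else xs ! (q - 1))" if "q < Suc (Suc n)" for q
        using nth_rotate_right[OF ne, of q] that N by (simp add: ys_def)
      have lenD: "length (D zs i) = Suc n" if "length zs = Suc (Suc n)" "i \<le> n" for zs i
        using that by (simp add: D_def)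
      have nthD: "D zs i ! q = (if q < i then zs ! q else if q = i then zs ! i * zs ! Suc i else zs ! Suc q)"
        if "length zs = Suc (Suc n)" "i \<le> n" "q < Suc n" for zs i q
        using that by (auto simp: D_def nth_append min_def nth_Cons')
      have lenE: "length (E zs) = Suc n" if "length zs = Suc (Suc n)" for zs
        using that by (simp add: E_def)
      have nthE: "E zs ! q = (if q = 0 then zs ! Suc n * zs ! 0 else zs ! q)"
        if "length zs = Suc (Suc n)" "q < Suc n" for zs q
      proof -
        have "zs \<noteq> []" using that by auto
        then show ?thesis using that
          by (auto simp: E_def nth_Cons' last_conv_nth hd_conv_nth nth_butlast nth_tl)
      qed
      have b: "hochschild_b (tens zs) = (\<Sum>i\<le>n. (-1) ^ i *\<^sub>R tens (D zs i)) + (-1) ^ Suc n *\<^sub>R tens (E zs)"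
        if "length zs = Suc (Suc n)" for zs
        using that by (simp add: hochschild_b_tens hochschild_b_list_def D_def E_def lessThan_Suc_atMost)
      have c: "abs_cyclic_tensor (hochschild_b (tens zs)) =
          (\<Sum>i\<le>n. (-1) ^ i *\<^sub>R cyc (D zs i)) + (-1) ^ Suc n *\<^sub>R cyc (E zs)"
        if "length zs = Suc (Suc n)" for zs
        by (simp only: b[OF that] q.add q.sum q.scale cyc_def)
      have rot: "cyc zs = (-1) ^ n *\<^sub>R cyc ws"
        if "length zs = Suc n" "length ws = Suc n" "ws ! 0 = zs ! n"
          "\<And>q. q < n \<Longrightarrow> ws ! Suc q = zs ! q" for zs ws :: "'a list"
      proof -
        have ne: "zs \<noteq> []" using that(1) by auto
        have "last zs # butlast zs = ws"
        proof (rule nth_equalityI)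
          show "length (last zs # butlast zs) = length ws" using that(1,2) by simp
          fix q assume "q < length (last zs # butlast zs)"
          then have q: "q < Suc n" using that(1) by simp
          show "(last zs # butlast zs) ! q = ws ! q"
            using nth_rotate_right[OF ne, of q] q that(1,3) that(4)[of "q - 1"]
            by (cases q) auto
        qed
        then show ?thesis using cyc_rotate[OF ne] that(1) by simp
      qed
      have D0: "D ys 0 = E xs"
        by (rule nth_equalityI) (auto simp: lenD lenE nthD nthE N Ny ynth)
      have DS: "cyc (D ys (Suc i)) = (-1) ^ n *\<^sub>R cyc (D xs i)" if i: "i < n" for i
      proof -
        have "cyc (D xs i) = (-1) ^ n *\<^sub>R cyc (D ys (Suc i))"
          by (rule rot) (use i in \<open>auto simp: lenD nthD N Ny ynth\<close>)
        then show ?thesis by (simp add: power_mult_distrib[symmetric])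
      qed
      have Ey: "cyc (E ys) = (-1) ^ n *\<^sub>R cyc (D xs n)"
      proof -
        have "cyc (D xs n) = (-1) ^ n *\<^sub>R cyc (E ys)"
          by (rule rot) (auto simp: lenD lenE nthD nthE N Ny ynth)
        then show ?thesis by (simp add: power_mult_distrib[symmetric])
      qed
      have s: "(-1::real) ^ n * (-1) ^ n = 1" by (simp add: power_mult_distrib[symmetric])
      have "abs_cyclic_tensor (hochschild_b (tens ys)) =
          (\<Sum>i\<le>n. (-1) ^ i *\<^sub>R cyc (D ys i)) + (-1) ^ Suc n *\<^sub>R cyc (E ys)"
        by (rule c[OF Ny])
      also have "(\<Sum>i\<le>n. (-1) ^ i *\<^sub>R cyc (D ys i))
          = cyc (E xs) + (\<Sum>i<n. (-1) ^ Suc i *\<^sub>R cyc (D ys (Suc i)))"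
        unfolding sum.atMost_shift by (simp add: D0)
      also have "(\<Sum>i<n. (-1) ^ Suc i *\<^sub>R cyc (D ys (Suc i)))
          = - ((-1) ^ n *\<^sub>R (\<Sum>i<n. (-1) ^ i *\<^sub>R cyc (D xs i)))"
        by (simp add: DS scaleR_sum_right sum_negf mult.commute)
      also have "(-1) ^ Suc n *\<^sub>R cyc (E ys) = - cyc (D xs n)"
        using s by (simp add: Ey)
      finally have "(-1) ^ Suc n *\<^sub>R abs_cyclic_tensor (hochschild_b (tens ys)) =
          (\<Sum>i<n. (-1) ^ i *\<^sub>R cyc (D xs i)) + (-1) ^ n *\<^sub>R cyc (D xs n) + (-1) ^ Suc n *\<^sub>R cyc (E xs)"
        by (simp add: scaleR_add_right scaleR_diff_right)
      also have "\<dots> = abs_cyclic_tensor (hochschild_b (tens xs))"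
        unfolding c[OF N] by (simp add: lessThan_Suc_atMost[symmetric])
      finally show ?thesis
        using N ne by (simp add: cyclic_t_tens ys_def[symmetric] b.scale q.scale b.neg q.neg)
    qed
  qed
  moreover obtain y where "x = y - cyclic_t y"
    using assms by (auto simp: cyclic_relations_def)
  ultimately show ?thesis
    by (simp add: cyclic_tensor.abs_eq_iff b.diff)
qed

lift_definition cyclic_b :: "'a::real_algebra cyclic_tensor \<Rightarrow> 'a cyclic_tensor" is hochschild_b
  using hochschild_b_cyclic_relations linear_diff[OF linear_hochschild_b] by metis

definition cyclic_homology :: "nat \<Rightarrow> 'a::real_algebra cyclic_tensor set set" where
  "cyclic_homology n = homology cyclic_chains cyclic_b n"


section \<open>From Lie algebra homology to cyclic homology\<close>

text \<open>\<open>S\<^sub>n\<close> permutes \<open>{1..n}\<close>, where \<open>n + 1\<close> is the length of the list.\<close>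

definition theta_list :: "'a::real_vector list \<Rightarrow> 'a cyclic_tensor" where
  "theta_list xs = (\<Sum>\<sigma> | \<sigma> permutes {1..<length xs}.
     of_int (sign \<sigma>) *\<^sub>R cyc (map (\<lambda>i. xs ! inv \<sigma> i) [0..<length xs]))"

definition theta :: "'a::real_vector exterior \<Rightarrow> 'a cyclic_tensor" where
  "theta = exterior_lift theta_list"

lemma multilinear_theta_list: "multilinear theta_list"
proof (rule multilinearI_nth)
  fix xs :: "'a list" and k
  assume k: "k < length xs"
  let ?F = "\<lambda>\<sigma> a. map (\<lambda>i. xs[k := a] ! inv \<sigma> i) [0..<length xs]"
  have "linear (\<lambda>a. cyc (?F \<sigma> a))" if "\<sigma> permutes {1..<length xs}" for \<sigma>
  proof -
    have p: "\<sigma> permutes {..<length xs}"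
      by (rule permutes_subset[OF that]) auto
    have lt: "inv \<sigma> q < length xs \<longleftrightarrow> q < length xs" for q
      using permutes_in_image[OF permutes_inv[OF p], of q] by simp
    have eq: "inv \<sigma> q = k \<longleftrightarrow> q = \<sigma> k" for q
      using permutes_inverses[OF p] by metis
    have "\<sigma> k < length xs" using permutes_in_image[OF p, of k] k by simp
    then show ?thesis
      by (intro linear_slot[OF multilinear_cyc linear_ident, of "\<sigma> k" "length xs"])
        (auto simp: nth_list_update lt eq permutes_inverses[OF p] k)
  qed
  then have "linear (\<lambda>a. \<Sum>\<sigma> | \<sigma> permutes {1..<length xs}. of_int (sign \<sigma>) *\<^sub>R cyc (?F \<sigma> a))"
    by (intro linear_compose_sum ballI linear_compose_scale_right) auto
  then show "linear (\<lambda>a. theta_list (xs[k := a]))"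
    by (simp add: theta_list_def)
qed

lemma alternating_theta_list: "alternating theta_list"
  unfolding alternating_def
proof (intro conjI allI)
  show "multilinear theta_list" by (rule multilinear_theta_list)
  fix u v :: "'a list" and a
  define xs where "xs = u @ [a, a] @ v"
  define k where "k = length u"
  define n where "n = length xs - 1"
  have N: "length xs = Suc n" and k: "k < n" by (auto simp: xs_def k_def n_def)
  have xk: "xs ! k = a" "xs ! Suc k = a" by (simp_all add: xs_def k_def nth_append)
  define S where "S = {\<pi>. \<pi> permutes {..<Suc n}}"
  define L where "L \<pi> = map (\<lambda>i. xs ! inv \<pi> i) [0..<Suc n]" for \<pi> :: "nat \<Rightarrow> nat"
  define F where "F \<pi> = of_int (sign \<pi>) *\<^sub>R cyc (L \<pi>)" for \<pi>
  define c where "c m i = (if i < m then Suc i else if i = m then 0 else i)" for m i :: nat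
  have c_Suc: "c (Suc m) = transpose 0 (Suc m) \<circ> c m" for m
    by (auto simp: c_def fun_eq_iff transpose_def)
  have c_perm: "c m permutes {..<Suc m}" for m
  proof (induction m)
    case 0
    have "c 0 = id" by (auto simp: c_def fun_eq_iff)
    then show ?case by (simp only: permutes_id)
  next
    case (Suc m)
    have "c m permutes {..<Suc (Suc m)}" by (rule permutes_subset[OF Suc]) auto
    then show ?case unfolding c_Suc by (rule permutes_compose[OF _ permutes_swap_id]) auto
  qed
  have c_sign: "sign (c m) = (-1) ^ m" for m
  proof (induction m)
    case 0
    have "c 0 = id" by (auto simp: c_def fun_eq_iff)
    then show ?case by simp
  next
    case (Suc m)
    have pc: "permutation (c m)" using c_perm by (rule permutes_imp_permutation[rotated]) simp
    then show ?case
      unfolding c_Suc sign_compose[OF permutation_swap_id pc] by (simp add: sign_swap_id Suc)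
  qed
  have permS: "permutation \<pi>" if "\<pi> \<in> S" for \<pi>
    using that unfolding S_def by (auto intro: permutes_imp_permutation[of "{..<Suc n}"])
  have F_c: "F (c n \<circ> \<pi>) = F \<pi>" if \<pi>: "\<pi> \<in> S" for \<pi>
  proof -
    have cn: "c n \<in> S" using c_perm by (simp add: S_def)
    have inv: "inv (c n \<circ> \<pi>) = inv \<pi> \<circ> inv (c n)"
      using cn \<pi> by (simp add: S_def o_inv_distrib permutes_bij)
    have c0: "inv (c n) 0 = n"
      using c_perm[of n] by (subst permutes_inv_eq[OF c_perm]) (simp add: c_def)
    have cS: "inv (c n) (Suc q) = q" if "q < n" for q
      using that by (subst permutes_inv_eq[OF c_perm]) (simp add: c_def)
    have lenL: "length (L \<rho>) = Suc n" for \<rho> by (simp add: L_def)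
    have ne: "L \<pi> \<noteq> []" using lenL[of \<pi>] by auto
    have nthL: "L \<rho> ! q = xs ! inv \<rho> q" if "q < Suc n" for \<rho> q
      using that by (simp add: L_def del: upt_Suc)
    have "L (c n \<circ> \<pi>) = last (L \<pi>) # butlast (L \<pi>)"
    proof (rule nth_equalityI)
      show "length (L (c n \<circ> \<pi>)) = length (last (L \<pi>) # butlast (L \<pi>))"
        by (simp add: lenL)
      fix q assume "q < length (L (c n \<circ> \<pi>))"
      then have q: "q < Suc n" by (simp add: lenL)
      show "L (c n \<circ> \<pi>) ! q = (last (L \<pi>) # butlast (L \<pi>)) ! q"
        using nth_rotate_right[OF ne, of q] q
        by (cases q) (simp_all add: lenL nthL inv c0 cS)
    qed
    then have "cyc (L \<pi>) = (-1) ^ n *\<^sub>R cyc (L (c n \<circ> \<pi>))"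
      using cyc_rotate[OF ne] by (simp add: lenL)
    then show ?thesis
      using sign_compose[OF permS[OF cn] permS[OF \<pi>]] by (simp add: F_def c_sign)
  qed
  define P where "P p = {\<pi> \<in> S. \<pi> 0 = p}" for p
  have finS: "finite S" by (simp add: S_def finite_permutations)
  have step: "sum F (P (Suc p)) = sum F (P p)" if p: "p < n" for p
  proof (rule sum.reindex_bij_witness[of _ "\<lambda>\<pi>. c n \<circ> \<pi>" "\<lambda>\<pi>. inv (c n) \<circ> \<pi>"])
    note ci = permutes_inv_o[OF c_perm[of n]]
    fix \<pi> :: "nat \<Rightarrow> nat"
    show "c n \<circ> (inv (c n) \<circ> \<pi>) = \<pi>" "inv (c n) \<circ> (c n \<circ> \<pi>) = \<pi>"
      by (simp_all add: o_assoc ci)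
    show "inv (c n) \<circ> \<pi> \<in> P p" if "\<pi> \<in> P (Suc p)"
    proof -
      have "inv (c n) (Suc p) = p"
        using p by (subst permutes_inv_eq[OF c_perm]) (simp add: c_def)
      then show ?thesis
        using that permutes_compose[OF _ permutes_inv[OF c_perm[of n]]] by (simp add: P_def S_def)
    qed
    show "F (inv (c n) \<circ> \<pi>) = F \<pi>" if "\<pi> \<in> P (Suc p)"
    proof -
      have "inv (c n) \<circ> \<pi> \<in> S"
        using that permutes_compose[OF _ permutes_inv[OF c_perm[of n]]] by (simp add: P_def S_def)
      from F_c[OF this] show ?thesis by (simp add: o_assoc ci)
    qed
    show "c n \<circ> \<pi> \<in> P (Suc p)" if "\<pi> \<in> P p"
      using that p permutes_compose[OF _ c_perm[of n]] by (simp add: P_def S_def) (simp add: c_def)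
  qed
  have const: "sum F (P p) = sum F (P 0)" if "p \<le> n" for p
    using that by (induction p) (use step in auto)
  have "S = (\<Union>p\<in>{..n}. P p)"
  proof -
    have "\<pi> 0 \<le> n" if "\<pi> \<in> S" for \<pi>
      using that permutes_in_image[of \<pi> "{..<Suc n}" 0] by (simp add: S_def)
    then show ?thesis by (auto simp: P_def)
  qed
  then have "sum F S = sum F (\<Union>p\<in>{..n}. P p)" by (rule arg_cong)
  also have "\<dots> = (\<Sum>p\<le>n. sum F (P p))"
    by (rule sum.UNION_disjoint) (use finS in \<open>auto simp: P_def\<close>)
  also have "\<dots> = (\<Sum>p\<le>n. sum F (P 0))"
    by (rule sum.cong[OF refl], rule const) simp
  also have "\<dots> = real (Suc n) *\<^sub>R sum F (P 0)"
    by (simp add: sum_constant_scaleR)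
  finally have tot: "sum F S = real (Suc n) *\<^sub>R sum F (P 0)" .
  let ?t = "transpose k (Suc k)"
  have t: "?t permutes {..<Suc n}" using k by (intro permutes_swap_id) auto
  have F_t: "F (\<pi> \<circ> ?t) = - F \<pi>" if \<pi>: "\<pi> \<in> S" for \<pi>
  proof -
    have "inv (\<pi> \<circ> ?t) = ?t \<circ> inv \<pi>"
      using \<pi> by (simp add: S_def o_inv_distrib permutes_bij)
    moreover have "xs ! ?t m = xs ! m" for m
      by (simp add: transpose_def xk)
    ultimately have "L (\<pi> \<circ> ?t) = L \<pi>" by (simp add: L_def)
    then show ?thesis
      using sign_compose[OF permS[OF \<pi>] permutation_swap_id] by (simp add: F_def sign_swap_id)
  qed
  have "sum F S = (\<Sum>\<pi>\<in>S. F (\<pi> \<circ> ?t))"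
    using sum_permutations_compose_right[OF t, of F] by (simp add: S_def)
  also have "\<dots> = - sum F S" by (simp add: F_t sum_negf)
  finally have "sum F S + sum F S = 0" by (simp only: eq_neg_iff_add_eq_0)
  then have "sum F S = 0" by (simp add: scaleR_2[symmetric])
  with tot have "sum F (P 0) = 0" by simp
  moreover have "P 0 = {\<sigma>. \<sigma> permutes {1..<length xs}}"
  proof (intro equalityI subsetI)
    fix \<pi> assume "\<pi> \<in> P 0"
    then have \<pi>: "\<pi> permutes {..<Suc n}" "\<pi> 0 = 0" by (auto simp: P_def S_def)
    have "\<pi> permutes {1..<Suc n}"
      by (rule permutes_superset[OF \<pi>(1)]) (use \<pi>(2) in \<open>auto simp: not_less_eq_eq\<close>)
    then show "\<pi> \<in> {\<sigma>. \<sigma> permutes {1..<length xs}}" by (simp add: N)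
  next
    fix \<pi> assume "\<pi> \<in> {\<sigma>. \<sigma> permutes {1..<length xs}}"
    then have \<pi>: "\<pi> permutes {1..<Suc n}" by (simp add: N)
    have "\<pi> permutes {..<Suc n}" by (rule permutes_subset[OF \<pi>]) auto
    moreover have "\<pi> 0 = 0" using permutes_not_in[OF \<pi>, of 0] by simp
    ultimately show "\<pi> \<in> P 0" by (simp add: P_def S_def)
  qed
  ultimately show "theta_list (u @ [a, a] @ v) = 0"
    unfolding theta_list_def xs_def[symmetric] by (simp add: F_def L_def N del: upt_Suc)
qed

lemma theta_wedge: "theta (wedge xs) = theta_list xs"
  unfolding theta_def by (rule exterior_lift_wedge[OF alternating_theta_list])

definition commutator :: "'a::real_algebra \<Rightarrow> 'a \<Rightarrow> 'a" where
  "commutator a b = a * b - b * a"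

text \<open>
  \<open>\<mu>\<^sub>2\<close> in degree \<open>n\<close>, from the homology of \<open>g\<close> to that of \<open>U(g)\<close>, and
  \<open>\<theta>\<^sub>* : H\<^sub>n\<^sub>+\<^sub>1(A) \<rightarrow> HC\<^sub>n(A)\<close>, with the commutator bracket on \<open>U(g)\<close> and \<open>A\<close>.
\<close>

definition mu2 :: "nat \<Rightarrow> 'a::real_lie_algebra exterior set \<Rightarrow> 'a uea exterior set" where
  "mu2 n = lie_homology_map commutator uea_incl n"

definition theta_star :: "nat \<Rightarrow> 'a::real_algebra exterior set \<Rightarrow> 'a cyclic_tensor set" where
  "theta_star n = induced_map cyclic_chains cyclic_b n theta"

end

theory Submission
  imports Defs "HOL-Analysis.Product_Vector"
begin

text \<open>
  Write \<open>W\<close> for the Lie algebra of polynomial vector fields and \<open>w = e\<^sub>-\<^sub>1 \<and> e\<^sub>0 \<and> e\<^sub>1\<close>. Two things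
  have to be shown: \<open>H\<^sub>3(W)\<close> is spanned by the class of \<open>w\<close>, and the image of that class in
  \<open>HC\<^sub>2(U(W))\<close> is nonzero, which is seen by evaluating a cyclic 2-cocycle on it.

  For the first, \<open>e\<^sub>0\<close> acts semisimply on the exterior powers of \<open>W\<close>, and by Cartan's formula the
  Lie derivative along \<open>e\<^sub>0\<close> is homotopic to zero, with homotopy \<open>z \<mapsto> e\<^sub>0 \<and> z\<close>. So the homology is
  carried by the chains of weight 0, and in degree 3 these are the multiples of \<open>w\<close>, because
  \<open>-1 + 0 + 1\<close> is the only way to write 0 as a sum of three distinct integers \<open>\<ge> -1\<close>
  (\<open>cycle_3_homologous_gv\<close>).

  For the second, the Godbillon-Vey class in \<open>H\<^sup>3(W; \<real>) = Ext\<^sup>3(\<real>, \<real>)\<close>, taken over \<open>U(W)\<close>, is a Yoneda product of three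
  extensions of \<open>W\<close>-modules. Let \<open>F\<^sub>0\<close> be the functions and \<open>F\<^sub>1\<close> the 1-forms with polynomial
  coefficients. The de Rham sequence
  \<open>0 \<rightarrow> \<real> \<rightarrow> F\<^sub>0 \<rightarrow> F\<^sub>1 \<rightarrow> 0\<close> is one extension; the others, of \<open>F\<^sub>0\<close> by \<open>F\<^sub>1\<close> and of \<open>\<real>\<close> by \<open>F\<^sub>0\<close>, are
  given by the 1-cocycles \<open>f d/dx \<mapsto> f'' dx\<close> and \<open>f d/dx \<mapsto> f'\<close>. All of these are modules over
  \<open>U(W)\<close>, and a linear splitting of each turns their product into an explicit 3-cocycle \<open>c\<close> of the
  bar complex of \<open>U(W)\<close>, with \<open>c(f, g, h) = f(0) g''(0) h'(0)\<close> on vector fields. The sum of \<open>c\<close>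
  over cyclic rotations is a cyclic 2-cocycle (the transpose of Connes' operator \<open>B\<close>), so it is
  defined on \<open>HC\<^sub>2(U(W))\<close>; on \<open>\<theta>(w)\<close> it is the antisymmetrization of \<open>c\<close>, whose value at
  \<open>1, x, x\<^sup>2\<close> is \<open>-2\<close>. Hence the coefficient of \<open>w\<close> in a class of \<open>H\<^sub>3(W)\<close> can be read off from any
  representative of the image in \<open>HC\<^sub>2(U(W))\<close> (\<open>gv_functional_on_image\<close>).
\<close>


section \<open>Modules over the enveloping algebra and their extensions\<close>

instantiation poly :: ("{real_algebra_1, comm_ring_1}") real_vector
begin

definition scaleR_poly :: "real \<Rightarrow> 'a poly \<Rightarrow> 'a poly" where
  "scaleR_poly r p = smult (of_real r) p"

instance
  by standard (simp_all add: scaleR_poly_def smult_add_left smult_add_right)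

end

lemma linear_foldr:
  assumes "\<And>x. linear (\<rho> x)"
  shows "linear (foldr \<rho> xs)"
proof (induction xs)
  case (Cons x xs)
  from linear_compose[OF Cons assms] show ?case by (simp add: o_def)
qed (simp add: linear_ident)

text \<open>
  An action is recorded by the operator of each Lie algebra element. It extends to the tensor
  algebra by letting \<open>x\<^sub>1 \<otimes> \<cdots> \<otimes> x\<^sub>n\<close> act as the composite of the operators of \<open>x\<^sub>1, \<dots>, x\<^sub>n\<close>.
\<close>

definition tensor_act :: "('a::real_vector \<Rightarrow> 'v::real_vector \<Rightarrow> 'v) \<Rightarrow> 'a tensor \<Rightarrow> 'v \<Rightarrow> 'v" where
  "tensor_act \<rho> t v = tensor_lift (\<lambda>xs. foldr \<rho> xs v) t"

definition uea_act :: "('a::real_lie_algebra \<Rightarrow> 'v::real_vector \<Rightarrow> 'v) \<Rightarrow> 'a uea \<Rightarrow> 'v \<Rightarrow> 'v" where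
  "uea_act \<rho> a = tensor_act \<rho> (rep_uea a)"

lemma uea_cases: obtains t where "a = abs_uea t"
  using Quotient3_abs_rep[OF Quotient3_uea] by metis

locale lie_rep =
  fixes \<rho> :: "'a::real_lie_algebra \<Rightarrow> 'v::real_vector \<Rightarrow> 'v"
  assumes linear_left: "\<And>v. linear (\<lambda>x. \<rho> x v)"
    and linear_right: "\<And>x. linear (\<rho> x)"
    and bracket: "\<And>x y v. \<rho> (lie_bracket x y) v = \<rho> x (\<rho> y v) - \<rho> y (\<rho> x v)"
begin

lemma multilinear_foldr: "multilinear (\<lambda>xs. foldr \<rho> xs v)"
  unfolding multilinear_def
proof (intro allI)
  fix us vs
  show "linear (\<lambda>a. foldr \<rho> (us @ [a] @ vs) v)"
    using linear_compose[OF linear_left[of "foldr \<rho> vs v"] linear_foldr[of \<rho> us, OF linear_right]]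
    by (simp add: o_def)
qed

lemma tensor_act_tens: "tensor_act \<rho> (tens xs) v = foldr \<rho> xs v"
  by (simp add: tensor_act_def multilinear_foldr)

lemma linear_tensor_act_left: "linear (\<lambda>t. tensor_act \<rho> t v)"
  unfolding tensor_act_def by (rule linear_tensor_lift[OF multilinear_foldr])

lemma linear_tensor_act: "linear (tensor_act \<rho> t)"
proof (rule linearI)
  note lin = linear_tensor_act_left
  fix v w r
  show "tensor_act \<rho> t (v + w) = tensor_act \<rho> t v + tensor_act \<rho> t w"
    by (rule linear_eq_on_tens[of "\<lambda>t. tensor_act \<rho> t (v + w)"
          "\<lambda>t. tensor_act \<rho> t v + tensor_act \<rho> t w"])
      (simp_all add: lin linear_compose_add tensor_act_tens linear_add[OF linear_foldr] linear_right)
  show "tensor_act \<rho> t (r *\<^sub>R v) = r *\<^sub>R tensor_act \<rho> t v"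
    by (rule linear_eq_on_tens[of "\<lambda>t. tensor_act \<rho> t (r *\<^sub>R v)"
          "\<lambda>t. r *\<^sub>R tensor_act \<rho> t v"])
      (simp_all add: lin linear_compose_scale_right tensor_act_tens linear_scale[OF linear_foldr]
        linear_right)
qed

lemma tensor_act_mult: "tensor_act \<rho> (s * t) v = tensor_act \<rho> s (tensor_act \<rho> t v)"
proof (rule linear_eq_on_tens[of "\<lambda>s. tensor_act \<rho> (s * t) v"])
  show "linear (\<lambda>s. tensor_act \<rho> (s * t) v)"
    using linear_compose[OF linear_tensor_mult_right linear_tensor_act_left] by (simp add: o_def)
  show "linear (\<lambda>s. tensor_act \<rho> s (tensor_act \<rho> t v))" by (rule linear_tensor_act_left)
  fix xs
  show "tensor_act \<rho> (tens xs * t) v = tensor_act \<rho> (tens xs) (tensor_act \<rho> t v)"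
  proof (rule linear_eq_on_tens[of "\<lambda>t. tensor_act \<rho> (tens xs * t) v"])
    show "linear (\<lambda>t. tensor_act \<rho> (tens xs * t) v)"
      using linear_compose[OF linear_tensor_mult_left linear_tensor_act_left] by (simp add: o_def)
    show "linear (\<lambda>t. tensor_act \<rho> (tens xs) (tensor_act \<rho> t v))"
      using linear_compose[OF linear_tensor_act_left linear_tensor_act] by (simp add: o_def)
  qed (simp add: tens_mult tensor_act_tens)
qed

text \<open>
  The bracket condition of a representation says exactly that the generators of the ideal act by
  zero; this makes the action of the enveloping algebra independent of representatives.
\<close>

lemma tensor_act_uea_ideal:
  assumes "t \<in> uea_ideal"
  shows "tensor_act \<rho> t v = 0"
  using assms unfolding uea_ideal_def two_sided_ideal_def
proof (rule span_induct)
  interpret L: linear "\<lambda>t. tensor_act \<rho> t v" by (rule linear_tensor_act_left)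
  show "subspace {t. tensor_act \<rho> t v = 0}"
    by (rule real_vector.subspaceI) (simp_all add: L.add L.scale)
  fix t :: "'a tensor"
  assume "t \<in> {u * r * v |u r v. r \<in> {tens [x, y] - tens [y, x] - tens [lie_bracket x y] |x y. True}}"
  then obtain u x y w where t: "t = u * (tens [x, y] - tens [y, x] - tens [lie_bracket x y]) * w"
    by blast
  have "tensor_act \<rho> (tens [x, y] - tens [y, x] - tens [lie_bracket x y]) z = 0" for z
    by (simp only: linear_diff[OF linear_tensor_act_left]) (simp add: tensor_act_tens bracket)
  then show "tensor_act \<rho> t v = 0"
    by (simp add: t tensor_act_mult linear_0[OF linear_tensor_act])
qed

lemma uea_act_abs: "uea_act \<rho> (abs_uea t) v = tensor_act \<rho> t v"
proof -
  have "rep_uea (abs_uea t) - t \<in> uea_ideal"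
    by (simp add: uea.abs_eq_iff[symmetric] Quotient3_abs_rep[OF Quotient3_uea])
  from tensor_act_uea_ideal[OF this] show ?thesis
    by (simp add: uea_act_def linear_diff[OF linear_tensor_act_left])
qed

lemma linear_uea_act_left: "linear (\<lambda>a. uea_act \<rho> a v)"
proof (rule linearI)
  fix a b r
  show "uea_act \<rho> (a + b) v = uea_act \<rho> a v + uea_act \<rho> b v"
    by (cases a rule: uea_cases; cases b rule: uea_cases)
      (simp add: plus_uea.abs_eq uea_act_abs linear_add[OF linear_tensor_act_left])
  show "uea_act \<rho> (r *\<^sub>R a) v = r *\<^sub>R uea_act \<rho> a v"
    by (cases a rule: uea_cases)
      (simp add: scaleR_uea.abs_eq uea_act_abs linear_scale[OF linear_tensor_act_left])
qed

lemma linear_uea_act: "linear (uea_act \<rho> a)"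
  unfolding uea_act_def by (rule linear_tensor_act)

lemma uea_act_mult: "uea_act \<rho> (a * b) v = uea_act \<rho> a (uea_act \<rho> b v)"
  by (cases a rule: uea_cases; cases b rule: uea_cases)
    (simp add: times_uea.abs_eq uea_act_abs tensor_act_mult)

lemma uea_act_incl: "uea_act \<rho> (uea_incl x) v = \<rho> x v"
  by (simp add: uea_incl_def uea_act_abs tensor_act_tens)

end

text \<open>
  The enveloping algebra is generated by the Lie algebra, so equivariance need only be checked on
  the latter.
\<close>

lemma uea_act_intertwining:
  assumes \<rho>: "lie_rep \<rho>" and \<rho>': "lie_rep \<rho>'" and f: "linear f"
    and comm: "\<And>x v. f (\<rho> x v) = \<rho>' x (f v)"
  shows "f (uea_act \<rho> a v) = uea_act \<rho>' a (f v)"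
proof -
  interpret \<rho>: lie_rep \<rho> by fact
  interpret \<rho>': lie_rep \<rho>' by fact
  obtain t where t: "a = abs_uea t" by (rule uea_cases)
  have "f (tensor_act \<rho> t v) = tensor_act \<rho>' t (f v)"
  proof (rule linear_eq_on_tens[of "\<lambda>t. f (tensor_act \<rho> t v)"])
    show "linear (\<lambda>t. f (tensor_act \<rho> t v))"
      using linear_compose[OF \<rho>.linear_tensor_act_left f] by (simp add: o_def)
    have "f (foldr \<rho> xs v) = foldr \<rho>' xs (f v)" for xs
      by (induction xs) (simp_all add: comm)
    then show "f (tensor_act \<rho> (tens xs) v) = tensor_act \<rho>' (tens xs) (f v)" for xs
      by (simp add: \<rho>.tensor_act_tens \<rho>'.tensor_act_tens)
  qed (rule \<rho>'.linear_tensor_act_left)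
  then show ?thesis by (simp add: t \<rho>.uea_act_abs \<rho>'.uea_act_abs)
qed

text \<open>
  A short exact sequence \<open>0 \<rightarrow> S \<rightarrow> E \<rightarrow> Q \<rightarrow> 0\<close> of modules together with a splitting \<open>r, s\<close> as vector
  spaces. The equation \<open>split\<close> encodes exactness in the middle.
\<close>

locale split_extension = S: lie_rep \<sigma> + E: lie_rep \<epsilon> + Q: lie_rep \<kappa>
  for \<sigma> :: "'a::real_lie_algebra \<Rightarrow> 's::real_vector \<Rightarrow> 's"
    and \<epsilon> :: "'a \<Rightarrow> 'e::real_vector \<Rightarrow> 'e"
    and \<kappa> :: "'a \<Rightarrow> 'q::real_vector \<Rightarrow> 'q" +
  fixes i :: "'s \<Rightarrow> 'e" and p :: "'e \<Rightarrow> 'q" and r :: "'e \<Rightarrow> 's" and s :: "'q \<Rightarrow> 'e"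
  assumes lin: "linear i" "linear p" "linear r" "linear s"
    and i_comm: "\<And>x v. i (\<sigma> x v) = \<epsilon> x (i v)"
    and p_comm: "\<And>x v. p (\<epsilon> x v) = \<kappa> x (p v)"
    and r_i: "\<And>v. r (i v) = v" and p_s: "\<And>w. p (s w) = w"
    and split: "\<And>u. u = i (r u) + s (p u)"
begin

text \<open>
  The failure of \<open>s\<close> to be equivariant: in terms of \<open>E = S \<oplus> Q\<close>, the off-diagonal block of the action
  of \<open>a\<close>. It is a Hochschild 1-cocycle of \<open>U(g)\<close> with values in the linear maps \<open>Q \<rightarrow> S\<close>, and
  represents the class of the extension in \<open>Ext\<^sup>1(Q, S)\<close>.
\<close>

definition cocycle :: "'a uea \<Rightarrow> 'q \<Rightarrow> 's" where
  "cocycle a w = r (uea_act \<epsilon> a (s w))"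

lemma linear_cocycle: "linear (cocycle a)"
  using linear_compose[OF lin(4) linear_compose[OF E.linear_uea_act lin(3)]]
  by (simp add: cocycle_def[abs_def] o_def)

lemma linear_cocycle_left: "linear (\<lambda>a. cocycle a w)"
  using linear_compose[OF E.linear_uea_act_left lin(3)] by (simp add: cocycle_def o_def)

text \<open>Multiplication of upper triangular block matrices.\<close>

lemma cocycle_mult: "cocycle (a * b) w = uea_act \<sigma> a (cocycle b w) + cocycle a (uea_act \<kappa> b w)"
proof -
  have "p (uea_act \<epsilon> b (s w)) = uea_act \<kappa> b w"
    using uea_act_intertwining[OF E.lie_rep_axioms Q.lie_rep_axioms lin(2), OF p_comm]
    by (simp add: p_s)
  then have "uea_act \<epsilon> b (s w) = i (cocycle b w) + s (uea_act \<kappa> b w)"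
    using split[of "uea_act \<epsilon> b (s w)"] by (simp only: cocycle_def)
  moreover have "r (uea_act \<epsilon> a (i v)) = uea_act \<sigma> a v" for v
    by (simp add: r_i flip: uea_act_intertwining[OF S.lie_rep_axioms E.lie_rep_axioms lin(1), OF i_comm])
  moreover have "cocycle (a * b) w = r (uea_act \<epsilon> a (uea_act \<epsilon> b (s w)))"
    by (simp add: cocycle_def E.uea_act_mult)
  ultimately show ?thesis
    by (simp only: linear_add[OF E.linear_uea_act] linear_add[OF lin(3)]) (simp add: cocycle_def)
qed

lemma cocycle_incl: "cocycle (uea_incl x) w = r (\<epsilon> x (s w))"
  by (simp add: cocycle_def E.uea_act_incl)

end


section \<open>The three extensions and the Godbillon-Vey cocycle on the enveloping algebra\<close>

definition antiderivative :: "real poly \<Rightarrow> real poly" where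
  "antiderivative p = (\<Sum>i\<le>degree p. monom (coeff p i / real (Suc i)) (Suc i))"

lemma coeff_antiderivative:
  "coeff (antiderivative p) n = (if n = 0 then 0 else coeff p (n - 1) / real n)"
proof (cases n)
  case (Suc m)
  have "coeff (antiderivative p) n =
      (\<Sum>i\<le>degree p. if i = m then coeff p i / real (Suc i) else 0)"
    by (simp add: antiderivative_def coeff_sum Suc)
  then show ?thesis by (simp add: Suc coeff_eq_0)
qed (simp add: antiderivative_def coeff_sum)

lemma linear_antiderivative: "linear antiderivative"
  by (rule linearI; rule poly_eqI)
    (simp_all add: coeff_antiderivative scaleR_poly_def add_divide_distrib)

lemma pderiv_antiderivative: "pderiv (antiderivative p) = p"
  by (rule poly_eqI) (simp add: coeff_pderiv coeff_antiderivative)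

text \<open>Integration from 0 splits the de Rham sequence, with evaluation at 0 as the retraction.\<close>

lemma antiderivative_pderiv: "p = [:poly p 0:] + antiderivative (pderiv p)"
  by (rule poly_eqI)
    (simp add: coeff_pderiv coeff_antiderivative poly_0_coeff_0 coeff_pCons split: nat.split)

definition trivial_act :: "poly_vector_field \<Rightarrow> real \<Rightarrow> real" where
  "trivial_act X r = 0"

definition function_act :: "poly_vector_field \<Rightarrow> real poly \<Rightarrow> real poly" where
  "function_act X p = vf_coeff X * pderiv p"

text \<open>
  The Lie derivative of the 1-form \<open>p dx\<close>, which is \<open>d(f p)\<close> for the vector field \<open>f d/dx\<close> because
  every 1-form on the line is closed.
\<close>

definition form_act :: "poly_vector_field \<Rightarrow> real poly \<Rightarrow> real poly" where
  "form_act X p = pderiv (vf_coeff X * p)"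

text \<open>
  The off-diagonal entries \<open>f''\<close> and \<open>f'\<close> in the next two actions are 1-cocycles of \<open>W\<close> with values
  in 1-forms and in functions: \<open>f'\<close> is the divergence of \<open>f d/dx\<close>, and \<open>f'' dx\<close> is its differential.
\<close>

definition form_ext_act :: "poly_vector_field \<Rightarrow> real poly \<times> real poly \<Rightarrow> real poly \<times> real poly" where
  "form_ext_act X = (\<lambda>(u, v).
     (form_act X u + pderiv (pderiv (vf_coeff X)) * v, function_act X v))"

definition function_ext_act :: "poly_vector_field \<Rightarrow> real poly \<times> real \<Rightarrow> real poly \<times> real" where
  "function_ext_act X = (\<lambda>(w, r). (function_act X w + smult r (pderiv (vf_coeff X)), 0))"

lemmas act_defs = trivial_act_def function_act_def form_act_def form_ext_act_def
  function_ext_act_def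

lemma vf_coeff_simps:
  "vf_coeff (X + Y) = vf_coeff X + vf_coeff Y"
  "vf_coeff (r *\<^sub>R X) = smult r (vf_coeff X)"
  "vf_coeff (lie_bracket X Y) = vf_coeff X * pderiv (vf_coeff Y) - vf_coeff Y * pderiv (vf_coeff X)"
  by (simp_all add: plus_poly_vector_field.rep_eq scaleR_poly_vector_field.rep_eq
      lie_bracket_poly_vector_field.rep_eq)

lemmas act_simps = act_defs vf_coeff_simps scaleR_poly_def pderiv_add pderiv_diff pderiv_mult
  pderiv_smult smult_add_right smult_add_left smult_diff_right

lemma lie_rep_trivial: "lie_rep trivial_act"
  by (standard; (rule linearI)?) (simp_all add: act_simps)

lemma lie_rep_function: "lie_rep function_act"
  by (standard; (rule linearI)?) (simp_all add: act_simps algebra_simps)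

lemma lie_rep_form: "lie_rep form_act"
  by (standard; (rule linearI)?) (simp_all add: act_simps algebra_simps)

lemma lie_rep_form_ext: "lie_rep form_ext_act"
  by (standard; (rule linearI)?) (simp_all add: act_simps algebra_simps split: prod.splits)

lemma lie_rep_function_ext: "lie_rep function_ext_act"
  by (standard; (rule linearI)?) (simp_all add: act_simps algebra_simps split: prod.splits)

lemma linear_poly_at: "linear (\<lambda>p::real poly. poly p a)"
  by (rule linearI) (simp_all add: scaleR_poly_def)

interpretation de_Rham: split_extension trivial_act function_act form_act
  "\<lambda>r. [:r:]" pderiv "\<lambda>p. poly p 0" antiderivative
  by (intro split_extension.intro lie_rep_trivial lie_rep_function lie_rep_form
      split_extension_axioms.intro linear_poly_at linear_antiderivative linearI)
    (simp_all add: pderiv_antiderivative flip: antiderivative_pderiv,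
      simp_all add: act_simps pderiv_pCons coeff_antiderivative poly_0_coeff_0)

interpretation form_ext: split_extension form_act form_ext_act function_act
  "\<lambda>u. (u, 0)" snd fst "\<lambda>v. (0, v)"
  by (intro split_extension.intro lie_rep_form_ext lie_rep_function lie_rep_form
      split_extension_axioms.intro linearI)
    (simp_all add: act_simps split: prod.splits)

interpretation function_ext: split_extension function_act function_ext_act trivial_act
  "\<lambda>w. (w, 0)" snd fst "\<lambda>r. (0, r)"
  by (intro split_extension.intro lie_rep_function_ext lie_rep_function lie_rep_trivial
      split_extension_axioms.intro linearI)
    (simp_all add: act_simps split: prod.splits)

text \<open>The augmentation of \<open>U(W)\<close>, obtained as the action on the trivial module.\<close>

definition counit :: "poly_vector_field uea \<Rightarrow> real" where
  "counit a = uea_act trivial_act a 1"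

lemma trivial_uea_act: "uea_act trivial_act a r = counit a * r"
  using linear_scale[OF lie_rep.linear_uea_act[OF lie_rep_trivial], of a r 1]
  by (simp add: counit_def mult.commute)

text \<open>
  The cup product of the three 1-cocycles, as a map \<open>\<real> \<rightarrow> F\<^sub>0 \<rightarrow> F\<^sub>1 \<rightarrow> \<real>\<close>.
\<close>

definition gv_cochain ::
  "poly_vector_field uea \<Rightarrow> poly_vector_field uea \<Rightarrow> poly_vector_field uea \<Rightarrow> real" where
  "gv_cochain a b c = de_Rham.cocycle a (form_ext.cocycle b (function_ext.cocycle c 1))"

lemma linear_gv_cochain:
  "linear (\<lambda>a. gv_cochain a b c)" "linear (\<lambda>b. gv_cochain a b c)" "linear (\<lambda>c. gv_cochain a b c)"
proof -
  note C = function_ext.linear_cocycle_left and A = de_Rham.linear_cocycle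
  show "linear (\<lambda>a. gv_cochain a b c)"
    unfolding gv_cochain_def by (rule de_Rham.linear_cocycle_left)
  show "linear (\<lambda>b. gv_cochain a b c)"
    using linear_compose[OF form_ext.linear_cocycle_left A] by (simp add: gv_cochain_def o_def)
  show "linear (\<lambda>c. gv_cochain a b c)"
    using linear_compose[OF linear_compose[OF C form_ext.linear_cocycle] A]
    by (simp add: gv_cochain_def o_def)
qed

text \<open>
  A product of 1-cocycles is a cocycle: after expanding the values on products by the 1-cocycle
  rule, each module operator standing between two factors appears twice, with opposite signs.
\<close>

lemma gv_cochain_cocycle:
  "counit a * gv_cochain b c d - gv_cochain (a * b) c d + gv_cochain a (b * c) d
     - gv_cochain a b (c * d) + gv_cochain a b c * counit d = 0"
proof -
  have "function_ext.cocycle c (counit d) = counit d *\<^sub>R function_ext.cocycle c 1"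
    using linear_scale[OF function_ext.linear_cocycle, of c "counit d" 1] by simp
  then show ?thesis
  by (simp add: gv_cochain_def de_Rham.cocycle_mult form_ext.cocycle_mult function_ext.cocycle_mult trivial_uea_act
      linear_add[OF de_Rham.linear_cocycle] linear_add[OF form_ext.linear_cocycle]
      linear_scale[OF de_Rham.linear_cocycle] linear_scale[OF form_ext.linear_cocycle])
qed

lemma gv_cochain_incl:
  "gv_cochain (uea_incl X) (uea_incl Y) (uea_incl Z) =
     poly (vf_coeff X * pderiv (pderiv (vf_coeff Y)) * pderiv (vf_coeff Z)) 0"
  by (simp add: gv_cochain_def de_Rham.cocycle_incl form_ext.cocycle_incl function_ext.cocycle_incl act_defs
      pderiv_antiderivative)


section \<open>From bar cocycles to cyclic cocycles\<close>

lemma linear_cyclic_b: "linear cyclic_b"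
proof (rule linearI)
  fix x y :: "'a cyclic_tensor" and r
  show "cyclic_b (x + y) = cyclic_b x + cyclic_b y"
    by transfer (simp add: linear_add[OF linear_hochschild_b] subspace_0[OF subspace_cyclic_relations])
  show "cyclic_b (r *\<^sub>R x) = r *\<^sub>R cyclic_b x"
    by (transfer) (simp add: linear_scale[OF linear_hochschild_b] subspace_0[OF subspace_cyclic_relations])
qed

lemma cyclic_b_cyc: "cyclic_b (cyc xs) = abs_cyclic_tensor (hochschild_b_list xs)"
  by (simp add: cyc_def cyclic_b.abs_eq hochschild_b_tens)

lemmas abs_cyclic_simps = linear_add[OF linear_abs_cyclic] linear_diff[OF linear_abs_cyclic]
  linear_neg[OF linear_abs_cyclic]

lemma cyclic_b_cyc_3: "cyclic_b (cyc [a, b, c]) = cyc [a * b, c] - cyc [a, b * c] + cyc [c * a, b]"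
  by (simp add: cyclic_b_cyc hochschild_b_list_def lessThan_Suc abs_cyclic_simps flip: cyc_def)

lemma cyclic_b_cyc_4:
  "cyclic_b (cyc [a, b, c, d]) =
     cyc [a * b, c, d] - cyc [a, b * c, d] + cyc [a, b, c * d] - cyc [d * a, b, c]"
  by (simp add: cyclic_b_cyc hochschild_b_list_def lessThan_Suc abs_cyclic_simps numeral_2_eq_2 flip: cyc_def)

text \<open>
  Rotations of triples are even, so they carry no sign in the cyclic complex and the sum over
  rotations descends to it. In other degrees the cochain is zero.
\<close>

definition cyclic_sum :: "('a \<Rightarrow> 'a \<Rightarrow> 'a \<Rightarrow> real) \<Rightarrow> 'a list \<Rightarrow> real" where
  "cyclic_sum c xs = (case xs of [x, y, z] \<Rightarrow> c x y z + c y z x + c z x y | _ \<Rightarrow> 0)"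

definition cyclic_cochain :: "('a::real_vector \<Rightarrow> 'a \<Rightarrow> 'a \<Rightarrow> real) \<Rightarrow> 'a cyclic_tensor \<Rightarrow> real" where
  "cyclic_cochain c x = tensor_lift (cyclic_sum c) (rep_cyclic_tensor x)"

lemma cyclic_sum_length: "length xs \<noteq> 3 \<Longrightarrow> cyclic_sum c xs = 0"
  by (auto simp: cyclic_sum_def split: list.splits)

lemma cyclic_sum_3: "cyclic_sum c [x, y, z] = c x y z + c y z x + c z x y"
  by (simp add: cyclic_sum_def)

locale trilinear =
  fixes c :: "'a::real_vector \<Rightarrow> 'a \<Rightarrow> 'a \<Rightarrow> real"
  assumes lin: "\<And>y z. linear (\<lambda>x. c x y z)" "\<And>x z. linear (\<lambda>y. c x y z)"
    "\<And>x y. linear (\<lambda>z. c x y z)"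
begin

lemma multilinear_cyclic_sum: "multilinear (cyclic_sum c)"
  unfolding multilinear_def
proof (intro allI)
  fix u v :: "'a list"
  show "linear (\<lambda>a. cyclic_sum c (u @ [a] @ v))"
  proof (cases "length (u @ v) = 2")
    case True
    then obtain x y where "u @ v = [x, y]"
      by (auto simp: numeral_2_eq_2 length_Suc_conv simp del: length_append)
    then show ?thesis
      by (auto simp: append_eq_Cons_conv cyclic_sum_3 intro!: linear_compose_add lin)
  next
    case False
    then show ?thesis by (simp add: cyclic_sum_length linear_zero)
  qed
qed

lemma cyclic_cochain_abs: "cyclic_cochain c (abs_cyclic_tensor t) = tensor_lift (cyclic_sum c) t"
proof -
  interpret f: linear "tensor_lift (cyclic_sum c)"
    by (rule linear_tensor_lift[OF multilinear_cyclic_sum])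
  have inv: "tensor_lift (cyclic_sum c) y = tensor_lift (cyclic_sum c) (cyclic_t y)" for y
  proof (rule linear_eq_on_tens[of _ "\<lambda>y. tensor_lift (cyclic_sum c) (cyclic_t y)"])
    show "linear (\<lambda>y. tensor_lift (cyclic_sum c) (cyclic_t y))"
      using linear_compose[OF linear_cyclic_t f.linear_axioms] by (simp add: o_def)
    fix xs :: "'a list"
    show "tensor_lift (cyclic_sum c) (tens xs) = tensor_lift (cyclic_sum c) (cyclic_t (tens xs))"
    proof (cases "length xs = 3")
      case True
      then obtain x y z where "xs = [x, y, z]"
        by (auto simp: numeral_3_eq_3 length_Suc_conv)
      then show ?thesis
        by (simp add: cyclic_t_tens multilinear_cyclic_sum cyclic_sum_3)
    next
      case False
      then show ?thesis
        by (cases "xs = []")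
          (simp_all add: cyclic_t_def tensor_lift_tens[OF multilinear_cyclic_t_list]
            cyclic_t_list_def multilinear_cyclic_sum f.scale cyclic_sum_length)
    qed
  qed (rule f.linear_axioms)
  have "rep_cyclic_tensor (abs_cyclic_tensor t) - t \<in> cyclic_relations"
    by (simp add: cyclic_tensor.abs_eq_iff[symmetric] Quotient3_abs_rep[OF Quotient3_cyclic_tensor])
  then obtain y where "rep_cyclic_tensor (abs_cyclic_tensor t) - t = y - cyclic_t y"
    by (auto simp: cyclic_relations_def)
  then have "tensor_lift (cyclic_sum c) (rep_cyclic_tensor (abs_cyclic_tensor t) - t) = 0"
    using inv[of y] by (simp add: f.diff)
  then show ?thesis by (simp add: cyclic_cochain_def f.diff)
qed

lemma cyclic_cochain_cyc: "cyclic_cochain c (cyc xs) = cyclic_sum c xs"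
  by (simp add: cyc_def cyclic_cochain_abs multilinear_cyclic_sum)

lemma linear_cyclic_cochain: "linear (cyclic_cochain c)"
proof (rule linearI)
  interpret f: linear "tensor_lift (cyclic_sum c)"
    by (rule linear_tensor_lift[OF multilinear_cyclic_sum])
  fix x y :: "'a cyclic_tensor" and r
  obtain s t where [simp]: "x = abs_cyclic_tensor s" "y = abs_cyclic_tensor t"
    using Quotient3_abs_rep[OF Quotient3_cyclic_tensor] by metis
  show "cyclic_cochain c (x + y) = cyclic_cochain c x + cyclic_cochain c y"
    by (simp add: plus_cyclic_tensor.abs_eq cyclic_cochain_abs f.add)
  show "cyclic_cochain c (r *\<^sub>R x) = r *\<^sub>R cyclic_cochain c x"
    by (simp add: scaleR_cyclic_tensor.abs_eq cyclic_cochain_abs f.scale)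
qed

end

text \<open>
  This is the compatibility of the coboundary with Connes' operator \<open>B\<close>. The alternating sum of the
  cocycle identity over the four rotations of a quadruple gives the value on the boundary, and the
  terms with a factor \<open>\<epsilon>\<close> cancel in pairs between neighbouring rotations.
\<close>

lemma cyclic_cochain_boundary:
  fixes c :: "'a::real_algebra \<Rightarrow> 'a \<Rightarrow> 'a \<Rightarrow> real"
  assumes "trilinear c"
    and \<delta>: "\<And>w x y z. \<epsilon> w * c x y z - c (w * x) y z + c w (x * y) z - c w x (y * z)
      + c w x y * \<epsilon> z = 0"
    and x: "x \<in> cyclic_chains 3"
  shows "cyclic_cochain c (cyclic_b x) = 0"
proof -
  interpret trilinear c by fact
  interpret f: linear "cyclic_cochain c" by (rule linear_cyclic_cochain)
  show ?thesis
    using x unfolding cyclic_chains_def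
  proof (rule span_induct)
    show "subspace {x. cyclic_cochain c (cyclic_b x) = 0}"
      by (rule real_vector.subspaceI)
        (simp_all add: linear_add[OF linear_cyclic_b] linear_scale[OF linear_cyclic_b]
          linear_0[OF linear_cyclic_b] f.add f.scale f.zero)
    fix x :: "'a cyclic_tensor"
    assume "x \<in> cyc ` {xs. length xs = Suc 3}"
    then obtain a b d e where x: "x = cyc [a, b, d, e]"
      by (auto simp: numeral_3_eq_3 length_Suc_conv)
    show "cyclic_cochain c (cyclic_b x) = 0"
      using \<delta>[of a b d e] \<delta>[of b d e a] \<delta>[of d e a b] \<delta>[of e a b d]
      by (simp add: x cyclic_b_cyc_4 f.add f.diff cyclic_cochain_cyc cyclic_sum_3 mult.commute)
  qed
qed


section \<open>Homology classes and induced maps\<close>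

lemma linear_span_closed:
  assumes "linear f" "\<And>b. b \<in> B \<Longrightarrow> f b \<in> span C" "x \<in> span B"
  shows "f x \<in> span C"
proof -
  have "f ` span B \<subseteq> span C"
    unfolding linear_span_image[OF assms(1), symmetric]
    by (rule span_minimal) (use assms(2) in auto)
  then show ?thesis using assms(3) by blast
qed

lemma equiv_homologous:
  assumes "linear d" "subspace (C n)" "subspace (C (Suc n))"
  shows "equiv (cycles C d n) (homologous C d n)"
proof -
  have B: "subspace (d ` C (Suc n))" by (rule linear_subspace_image[OF assms(1,3)])
  show ?thesis
  proof (rule equivI)
    show "homologous C d n \<subseteq> cycles C d n \<times> cycles C d n" by (auto simp: homologous_def)
    show "refl_on (cycles C d n) (homologous C d n)"
      using subspace_0[OF B] by (simp add: refl_on_def homologous_def)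
    show "sym (homologous C d n)"
    proof (rule symI)
      fix x y assume "(x, y) \<in> homologous C d n"
      then show "(y, x) \<in> homologous C d n"
        using subspace_neg[OF B, of "x - y"] by (simp add: homologous_def)
    qed
    show "trans (homologous C d n)"
    proof (rule transI)
      fix x y z assume "(x, y) \<in> homologous C d n" "(y, z) \<in> homologous C d n"
      then show "(x, z) \<in> homologous C d n"
        using subspace_add[OF B, of "x - y" "y - z"] by (simp add: homologous_def)
    qed
  qed
qed

lemma induced_mapI:
  assumes "z \<in> X" "f z \<in> cycles C' d' n" "0 \<in> d' ` C' (Suc n)"
  shows "f z \<in> induced_map C' d' n f X"
  using assms by (auto simp: induced_map_def homologous_def intro!: bexI[of _ z])

lemma induced_mapE:
  assumes "y \<in> induced_map C' d' n f X"
  obtains z where "z \<in> X" "f z - y \<in> d' ` C' (Suc n)"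
  using assms by (auto simp: induced_map_def homologous_def)

lemma subspace_exterior_power: "subspace (exterior_power n)"
  by (simp add: exterior_power_def)

lemma chain_map_on_span:
  assumes "linear d" "linear d'" "linear f" "x \<in> span B"
    and "\<And>b. b \<in> B \<Longrightarrow> d' (f b) = f (d b)"
  shows "d' (f x) = f (d x)"
  using linear_eq_on_span[OF linear_compose[OF assms(3,2)] linear_compose[OF assms(1,3)] _ assms(4)]
    assms(5) by simp

lemma subspace_boundaries: "linear d \<Longrightarrow> subspace (d ` exterior_power n)"
  unfolding exterior_power_def by (rule linear_subspace_image) simp_all


section \<open>The chain maps in low degrees\<close>

lemma linear_commutator: "linear (\<lambda>a. commutator a b)" "linear (commutator a)"
  by (rule linearI; simp add: commutator_def algebra_simps)+

lemma commutator_self: "commutator a a = 0"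
  by (simp add: commutator_def)

lemmas lie_d_commutator_wedge = lie_d_wedge[of commutator, OF linear_commutator commutator_self]

lemma lie_d_list_2: "lie_d_list br [a, b] = wedge [br a b]"
  by (simp add: lie_d_list_def lessThan_Suc)

lemma lie_d_list_3:
  "lie_d_list br [a, b, c] = wedge [br a b, c] - wedge [br a c, b] - wedge [a, br b c]"
  by (simp add: lie_d_list_def lessThan_Suc numeral_2_eq_2)

lemma lie_d_list_4:
  "lie_d_list br [a, b, c, d] = wedge [br a b, c, d] - wedge [br a c, b, d] - wedge [a, br b c, d]
     + wedge [br a d, b, c] + wedge [a, br b d, c] + wedge [a, b, br c d]"
  by (simp add: lie_d_list_def lessThan_Suc numeral_2_eq_2 numeral_3_eq_3)

lemma linear_lie_bracket: "linear (\<lambda>x. lie_bracket x y)" "linear (lie_bracket x)"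
  by (rule linearI; simp add: lie_bracket_add_left lie_bracket_add_right
      lie_bracket_scaleR_left lie_bracket_scaleR_right)+

lemmas lie_d_bracket_wedge = lie_d_wedge[of lie_bracket, OF linear_lie_bracket lie_bracket_self]

lemma linear_lie_d_bracket: "linear (lie_d lie_bracket)"
  unfolding lie_d_def
  by (intro linear_exterior_lift alternating_lie_d_list linear_lie_bracket lie_bracket_self)

lemma linear_lie_d_commutator: "linear (lie_d commutator)"
  unfolding lie_d_def
  by (intro linear_exterior_lift alternating_lie_d_list linear_commutator commutator_self)

text \<open>
  The sum may be reindexed by the inverse permutations, which have the same sign; in this form it is
  easier to enumerate.
\<close>

lemma theta_list_eq:
  "theta_list xs = (\<Sum>\<sigma> | \<sigma> permutes {1..<length xs}.
     of_int (sign \<sigma>) *\<^sub>R cyc (map (\<lambda>i. xs ! \<sigma> i) [0..<length xs]))"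
  unfolding theta_list_def
  by (subst sum_permutations_inverse)
     (auto intro!: sum.cong simp: sign_inverse permutes_inv_inv permutes_imp_permutation[of "{1..<length xs}"])

lemma theta_list_2: "theta_list [a, b] = cyc [a, b]"
proof -
  have I: "{1..<length [a, b]} = {1}" by auto
  show ?thesis
    unfolding theta_list_eq I by simp
qed

lemma theta_list_3: "theta_list [a, b, c] = cyc [a, b, c] - cyc [a, c, b]"
proof -
  have I: "{1..<length [a, b, c]} = insert 1 {2}" by auto
  show ?thesis
    unfolding theta_list_eq I
    by (subst sum_over_permutations_insert) (simp_all add: sign_swap_id transpose_def upt_rec)
qed

lemma theta_list_4:
  "theta_list [a, b, c, d] = cyc [a, b, c, d] - cyc [a, b, d, c] - cyc [a, c, b, d]
     + cyc [a, c, d, b] + cyc [a, d, b, c] - cyc [a, d, c, b]"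
proof -
  have I: "{1..<length [a, b, c, d]} = insert 1 (insert 2 {3})" by auto
  show ?thesis
    unfolding theta_list_eq I
    by (subst sum_over_permutations_insert, simp, simp, subst sum_over_permutations_insert)
      (simp_all add: sign_swap_id sign_compose permutation_swap_id transpose_def upt_rec)
qed

lemma cyc_3: "cyc [a, b, c] = cyc [b, c, a]" "cyc [a, b, c] = cyc [c, a, b]"
  using cyc_rotate[of "[a, b, c]"] cyc_rotate[of "[b, c, a]"] by simp_all

lemma linear_cyc_2: "linear (\<lambda>a. cyc [a, b])" "linear (\<lambda>b. cyc [a, b])"
  using multilinear_cyc[unfolded multilinear_def, rule_format, of "[]" "[b]"]
    multilinear_cyc[unfolded multilinear_def, rule_format, of "[a]" "[]"]
  by simp_all

lemma linear_cyc_3: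
  "linear (\<lambda>a. cyc [a, b, c])" "linear (\<lambda>b. cyc [a, b, c])" "linear (\<lambda>c. cyc [a, b, c])"
  using multilinear_cyc[unfolded multilinear_def, rule_format, of "[]" "[b, c]"]
    multilinear_cyc[unfolded multilinear_def, rule_format, of "[a]" "[c]"]
    multilinear_cyc[unfolded multilinear_def, rule_format, of "[a, b]" "[]"]
  by simp_all

lemma linear_theta: "linear theta"
  unfolding theta_def by (rule linear_exterior_lift[OF alternating_theta_list])

text \<open>
  On both sides the terms are the products of two of the factors, in either order, and they match up
  to cyclic rotation. Wedges of three and of four factors are what is needed for classes of degree 3:
  the former make up the cycles, the latter have the boundaries by which cycles may be changed.
\<close>

lemma theta_chain_map_wedge_3:
  "cyclic_b (theta (wedge [a, b, c])) = theta (lie_d commutator (wedge [a, b, c]))"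
  by (simp add: theta_wedge theta_list_3 theta_list_2 lie_d_commutator_wedge lie_d_list_3
      linear_diff[OF linear_cyclic_b] linear_diff[OF linear_theta] cyclic_b_cyc_3 commutator_def
      linear_diff[OF linear_cyc_2(1)] linear_diff[OF linear_cyc_2(2)])

lemma theta_chain_map_wedge_4:
  "cyclic_b (theta (wedge [a, b, c, d])) = theta (lie_d commutator (wedge [a, b, c, d]))"
  by (simp add: theta_wedge theta_list_3 theta_list_4 lie_d_commutator_wedge lie_d_list_4
      linear_diff[OF linear_cyclic_b] linear_diff[OF linear_theta] linear_add[OF linear_cyclic_b] 
      linear_add[OF linear_theta] cyclic_b_cyc_4 commutator_def
      linear_diff[OF linear_cyc_3(1)] linear_diff[OF linear_cyc_3(2)] linear_diff[OF linear_cyc_3(3)] cyc_3)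

lemma theta_chain_map:
  assumes "x \<in> exterior_power 3 \<or> x \<in> exterior_power 4"
  shows "cyclic_b (theta x) = theta (lie_d commutator x)"
proof -
  have "x \<in> span (wedge ` {xs. length xs = 3 \<or> length xs = 4})"
    using assms span_mono[of "wedge ` {xs. length xs = 3}" "wedge ` {xs. length xs = 3 \<or> length xs = 4}"]
      span_mono[of "wedge ` {xs. length xs = 4}" "wedge ` {xs. length xs = 3 \<or> length xs = 4}"]
    unfolding exterior_power_def by blast
  then show ?thesis
    by (rule chain_map_on_span[OF linear_lie_d_commutator linear_cyclic_b linear_theta])
      (auto simp: eval_nat_numeral length_Suc_conv theta_chain_map_wedge_3 theta_chain_map_wedge_4)
qed

lemma theta_cyclic_chains:
  assumes "x \<in> exterior_power (Suc n)"
  shows "theta x \<in> cyclic_chains n"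
proof -
  have *: "theta b \<in> cyclic_chains n" if "b \<in> wedge ` {xs. length xs = Suc n}" for b :: "'a exterior"
  proof -
    obtain xs where xs: "b = wedge xs" "length xs = Suc n" using \<open>b \<in> _\<close> by blast
    show ?thesis
      unfolding xs(1) theta_wedge theta_list_def cyclic_chains_def
      by (intro span_sum span_scale, rule span_base, rule imageI) (simp add: xs(2))
  qed
  show ?thesis
    unfolding cyclic_chains_def
    by (rule linear_span_closed[OF linear_theta _ assms[unfolded exterior_power_def]])
      (use * in \<open>auto simp: cyclic_chains_def\<close>)
qed

lemma linear_exterior_map:
  assumes "linear f"
  shows "linear (exterior_map f)"
proof -
  have "alternating (\<lambda>xs. wedge (map f xs))"
    unfolding alternating_def
  proof (intro conjI allI)
    show "multilinear (\<lambda>xs. wedge (map f xs))"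
      unfolding multilinear_def
    proof (intro allI)
      fix u v
      have "linear (\<lambda>a. wedge (map f u @ [a] @ map f v))"
        using multilinear_wedge unfolding multilinear_def by blast
      from linear_compose[OF assms this] show "linear (\<lambda>a. wedge (map f (u @ [a] @ v)))"
        by (simp add: o_def)
    qed
    have "wedge (map f u @ [f a, f a] @ map f v) = 0" for u a v
      using alternating_wedge unfolding alternating_def by blast
    then show "wedge (map f (u @ [a, a] @ v)) = 0" for u a v
      by simp
  qed
  then show ?thesis unfolding exterior_map_def by (rule linear_exterior_lift)
qed

text \<open>A homomorphism of Lie algebras induces a map of Chevalley-Eilenberg complexes.\<close>

lemma exterior_map_lie_d_list:
  assumes f: "linear f" and comm: "\<And>x y. f (br x y) = br' (f x) (f y)"
  shows "exterior_map f (lie_d_list br xs) = lie_d_list br' (map f xs)"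
proof -
  interpret F: linear "exterior_map f" by (rule linear_exterior_map[OF f])
  show ?thesis
    unfolding lie_d_list_def F.sum F.scale length_map
    by (intro sum.cong refl)
      (simp add: Let_def exterior_map_wedge[OF f] map_update comm flip: take_map drop_map)
qed

lemma exterior_map_exterior_power:
  assumes "linear f" "x \<in> exterior_power n"
  shows "exterior_map f x \<in> exterior_power n"
  unfolding exterior_power_def
  by (rule linear_span_closed[OF linear_exterior_map[OF assms(1)] _ assms(2)[unfolded exterior_power_def]])
    (auto simp: exterior_map_wedge[OF assms(1)] intro!: span_base)

definition mu :: "'a::real_lie_algebra exterior \<Rightarrow> 'a uea exterior" where
  "mu = exterior_map uea_incl"

lemma linear_mu: "linear mu"
  unfolding mu_def by (rule linear_exterior_map[OF linear_uea_incl])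

lemma mu_chain_map: "lie_d commutator (mu x) = mu (lie_d lie_bracket x)"
proof -
  have x: "x \<in> span (range wedge)"
  proof -
    obtain t where "x = abs_exterior t" by (rule exterior_cases)
    then have "x \<in> abs_exterior ` span (range tens)" using tensor_span by blast
    then show ?thesis
      by (simp add: linear_span_image[OF linear_abs_exterior, symmetric] image_image wedge_def)
  qed
  have comm: "uea_incl (lie_bracket a b) = commutator (uea_incl a) (uea_incl b)" for a b :: 'a
    by (simp add: uea_incl_bracket commutator_def)
  show ?thesis
    by (rule chain_map_on_span[OF linear_lie_d_bracket linear_lie_d_commutator linear_mu x])
      (auto simp: mu_def exterior_map_wedge[OF linear_uea_incl] lie_d_commutator_wedge
        lie_d_bracket_wedge exterior_map_lie_d_list[of _ lie_bracket commutator, OF linear_uea_incl, OF comm])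
qed


section \<open>The third homology of the polynomial vector fields\<close>

text \<open>\<open>vf n\<close> is \<open>x\<^sup>n d/dx\<close>, that is, \<open>e\<^sub>i\<close> is \<open>vf (i + 1)\<close>.\<close>

definition vf :: "nat \<Rightarrow> poly_vector_field" where
  "vf n = Vector_Field (monom 1 n)"

definition wedge_left :: "'a::real_vector \<Rightarrow> 'a exterior \<Rightarrow> 'a exterior" where
  "wedge_left x = exterior_lift (\<lambda>xs. wedge (x # xs))"

lemma alternating_wedge_Cons: "alternating (\<lambda>xs. wedge (x # xs))"
  unfolding alternating_def multilinear_def
proof (intro conjI allI)
  fix u v :: "'a list" and a
  have "linear (\<lambda>a. wedge ((x # u) @ [a] @ v))"
    using multilinear_wedge unfolding multilinear_def by blast
  then show "linear (\<lambda>a. wedge (x # u @ [a] @ v))" by simp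
  have "wedge ((x # u) @ [a, a] @ v) = 0"
    using alternating_wedge unfolding alternating_def by blast
  then show "wedge (x # u @ [a, a] @ v) = 0" by simp
qed

lemma wedge_left_wedge: "wedge_left x (wedge xs) = wedge (x # xs)"
  by (simp add: wedge_left_def exterior_lift_wedge[OF alternating_wedge_Cons])

lemma linear_wedge_left: "linear (wedge_left x)"
  unfolding wedge_left_def by (rule linear_exterior_lift[OF alternating_wedge_Cons])

lemma wedge_left_exterior_power:
  assumes "z \<in> exterior_power n"
  shows "wedge_left x z \<in> exterior_power (Suc n)"
  using assms unfolding exterior_power_def
proof (rule span_induct)
  show "subspace {z. wedge_left x z \<in> span (wedge ` {xs. length xs = Suc n})}"
    by (rule real_vector.subspaceI)
      (simp_all add: linear_0[OF linear_wedge_left] linear_add[OF linear_wedge_left]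
        linear_scale[OF linear_wedge_left] span_add span_scale span_zero)
qed (auto simp: wedge_left_wedge intro!: span_base)

lemma wedge_swap: "wedge [a, b] = - wedge [b, a]" "wedge [a, b, c] = - wedge [b, a, c]"
  "wedge [a, b, c] = - wedge [a, c, b]"
  using alternating_swap[OF alternating_wedge, of "[]" a b "[]"]
    alternating_swap[OF alternating_wedge, of "[]" a b "[c]"]
    alternating_swap[OF alternating_wedge, of "[a]" b c "[]"]
  by simp_all

lemma wedge_repeated: "wedge [a, a, b] = 0" "wedge [a, b, b] = 0" "wedge [a, b, a] = 0"
proof -
  show 1: "wedge [a, a, b] = 0" and "wedge [a, b, b] = 0"
    using alternating_nth[OF alternating_wedge, of 0 "[a, a, b]"]
      alternating_nth[OF alternating_wedge, of 1 "[a, b, b]"] by simp_all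
  show "wedge [a, b, a] = 0" using 1 wedge_swap(3)[of a b a] by simp
qed

lemma linear_wedge_2: "linear (\<lambda>a. wedge [a, b])" "linear (\<lambda>b. wedge [a, b])"
  using multilinear_wedge[unfolded multilinear_def, rule_format, of "[]" "[b]"]
    multilinear_wedge[unfolded multilinear_def, rule_format, of "[a]" "[]"]
  by simp_all

lemma linear_wedge_3:
  "linear (\<lambda>a. wedge [a, b, c])" "linear (\<lambda>b. wedge [a, b, c])" "linear (\<lambda>c. wedge [a, b, c])"
  using multilinear_wedge[unfolded multilinear_def, rule_format, of "[]" "[b, c]"]
    multilinear_wedge[unfolded multilinear_def, rule_format, of "[a]" "[c]"]
    multilinear_wedge[unfolded multilinear_def, rule_format, of "[a, b]" "[]"]
  by simp_all

text \<open>
  Cartan's formula taken as the definition, so that the homotopy to zero is built in. That this is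
  the action of \<open>x\<close> as a derivation is proved below in the degrees where it is used.
\<close>

definition lie_derivative :: "'a::real_lie_algebra \<Rightarrow> 'a exterior \<Rightarrow> 'a exterior" where
  "lie_derivative x z =
     lie_d lie_bracket (wedge_left x z) + wedge_left x (lie_d lie_bracket z)"

lemma linear_lie_derivative: "linear (lie_derivative x)"
  using linear_compose_add[OF linear_compose[OF linear_wedge_left linear_lie_d_bracket]
      linear_compose[OF linear_lie_d_bracket linear_wedge_left]]
  by (simp add: lie_derivative_def[abs_def] o_def)

lemma lie_derivative_wedge_2:
  "lie_derivative x (wedge [a, b]) = wedge [lie_bracket x a, b] + wedge [a, lie_bracket x b]"
  by (simp add: lie_derivative_def wedge_left_wedge lie_d_bracket_wedge lie_d_list_2 lie_d_list_3
      wedge_swap(1)[of "lie_bracket x b"])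

lemma lie_derivative_wedge_3:
  "lie_derivative x (wedge [a, b, c]) =
     wedge [lie_bracket x a, b, c] + wedge [a, lie_bracket x b, c] + wedge [a, b, lie_bracket x c]"
  by (simp add: lie_derivative_def wedge_left_wedge lie_d_bracket_wedge lie_d_list_3 lie_d_list_4
      linear_diff[OF linear_wedge_left] wedge_swap(2)[of "lie_bracket x b"]
      wedge_swap(2)[of "lie_bracket x c"] wedge_swap(3)[of a "lie_bracket x c"])

lemma lie_bracket_vf: "lie_bracket (vf i) (vf j) = (real j - real i) *\<^sub>R vf (i + j - 1)"
proof (cases "i + j = 0")
  case False
  then show ?thesis unfolding vf_def by (intro lie_bracket_monom) linarith
qed (simp add: lie_bracket_self)

text \<open>
  The bracket with \<open>vf 1 = e\<^sub>0\<close> multiplies \<open>vf n\<close> by its weight \<open>n - 1\<close>, so a wedge of \<open>m\<close> monomial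
  fields has as eigenvalue the sum of the exponents minus \<open>m\<close>.
\<close>

lemma lie_derivative_vf_2:
  "lie_derivative (vf 1) (wedge [vf i, vf j]) = (real (i + j) - 2) *\<^sub>R wedge [vf i, vf j]"
  by (simp add: lie_derivative_wedge_2 lie_bracket_vf linear_scale[OF linear_wedge_2(1)]
      linear_scale[OF linear_wedge_2(2)] flip: scaleR_add_left)

lemma lie_derivative_vf_3:
  "lie_derivative (vf 1) (wedge [vf i, vf j, vf k]) =
     (real (i + j + k) - 3) *\<^sub>R wedge [vf i, vf j, vf k]"
  by (simp add: lie_derivative_wedge_3 lie_bracket_vf linear_scale[OF linear_wedge_3(1)]
      linear_scale[OF linear_wedge_3(2)] linear_scale[OF linear_wedge_3(3)]
      flip: scaleR_add_left)

text \<open>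
  The bracket lowers the sum of exponents by one, which makes up for the drop in the number of
  factors. The truncated exponent \<open>i + j - 1\<close> is wrong only for \<open>i = j = 0\<close>, where the bracket is 0.
\<close>

lemma lie_derivative_bracket_vf:
  "lie_derivative (vf 1) (wedge [lie_bracket (vf i) (vf j), vf k]) =
     (real (i + j + k) - 3) *\<^sub>R wedge [lie_bracket (vf i) (vf j), vf k]"
proof (cases "i + j = 0")
  case True
  then show ?thesis
    by (simp add: lie_bracket_self linear_0[OF linear_wedge_2(1)] linear_0[OF linear_lie_derivative])
next
  case False
  then have "i + j - 1 + k + 1 = i + j + k" by linarith
  then have "real (i + j - 1 + k) - 2 = real (i + j + k) - 3" by linarith
  then have "lie_derivative (vf 1) (wedge [vf (i + j - 1), vf k]) =
      (real (i + j + k) - 3) *\<^sub>R wedge [vf (i + j - 1), vf k]"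
    by (simp only: lie_derivative_vf_2)
  then show ?thesis
    by (simp only: lie_bracket_vf linear_scale[OF linear_wedge_2(1)]
        linear_scale[OF linear_lie_derivative] scaleR_left_commute)
qed

lemma lie_derivative_d_vf_3:
  fixes i j k :: nat
  defines "z \<equiv> wedge [vf i, vf j, vf k]"
  shows "lie_derivative (vf 1) (lie_d lie_bracket z) = (real (i + j + k) - 3) *\<^sub>R lie_d lie_bracket z"
proof -
  have "lie_d lie_bracket z = wedge [lie_bracket (vf i) (vf j), vf k]
      - wedge [lie_bracket (vf i) (vf k), vf j] + wedge [lie_bracket (vf j) (vf k), vf i]"
    by (simp add: z_def lie_d_bracket_wedge lie_d_list_3 wedge_swap(1)[of "vf i"])
  then show ?thesis
    by (simp add: linear_add[OF linear_lie_derivative] linear_diff[OF linear_lie_derivative]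
      lie_derivative_bracket_vf scaleR_add_right scaleR_diff_right add_ac
      del: One_nat_def)
qed

text \<open>
  Indexing by the sum \<open>N\<close> of the exponents keeps the index natural; the weight is \<open>N - 3\<close>.
\<close>

definition weight_space :: "nat \<Rightarrow> poly_vector_field exterior set" where
  "weight_space N = span {wedge [vf i, vf j, vf k] | i j k. i + j + k = N}"

lemma weight_space_eigen:
  assumes "z \<in> weight_space N"
  shows "lie_derivative (vf 1) z = (real N - 3) *\<^sub>R z"
    "lie_derivative (vf 1) (lie_d lie_bracket z) = (real N - 3) *\<^sub>R lie_d lie_bracket z"
    "z \<in> exterior_power 3"
proof -
  note L = linear_add[OF linear_lie_derivative] linear_scale[OF linear_lie_derivative]
    linear_0[OF linear_lie_derivative] linear_add[OF linear_lie_d_bracket]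
    linear_scale[OF linear_lie_d_bracket] linear_0[OF linear_lie_d_bracket]
  show "lie_derivative (vf 1) z = (real N - 3) *\<^sub>R z"
    using assms unfolding weight_space_def
  proof (rule span_induct)
    show "subspace {z. lie_derivative (vf 1) z = (real N - 3) *\<^sub>R z}"
      by (rule real_vector.subspaceI) (simp_all add: L scaleR_add_right)
  qed (use lie_derivative_vf_3 in blast)
  show "lie_derivative (vf 1) (lie_d lie_bracket z) = (real N - 3) *\<^sub>R lie_d lie_bracket z"
    using assms unfolding weight_space_def
  proof (rule span_induct)
    show "subspace {z. lie_derivative (vf 1) (lie_d lie_bracket z) =
        (real N - 3) *\<^sub>R lie_d lie_bracket z}"
      by (rule real_vector.subspaceI) (simp_all add: L scaleR_add_right)
  qed (use lie_derivative_d_vf_3 in blast)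
  show "z \<in> exterior_power 3"
    using assms unfolding weight_space_def exterior_power_def
    by (rule subsetD[OF span_mono, rotated]) auto
qed

lemma vf_span: "X \<in> span (range vf)"
proof -
  have "vf_coeff X = (\<Sum>i\<le>degree (vf_coeff X). monom (coeff (vf_coeff X) i) i)"
    by (simp add: poly_as_sum_of_monoms)
  also have "\<dots> = vf_coeff (\<Sum>i\<le>degree (vf_coeff X). coeff (vf_coeff X) i *\<^sub>R vf i)"
  proof -
    have "vf_coeff (sum g A) = (\<Sum>a\<in>A. vf_coeff (g a))" if "finite A" for g :: "nat \<Rightarrow> _" and A
      using that
      by induction (simp_all add: zero_poly_vector_field.rep_eq plus_poly_vector_field.rep_eq)
    then show ?thesis
      by (simp add: scaleR_poly_vector_field.rep_eq vf_def Vector_Field_inverse smult_monom)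
  qed
  finally have "X = (\<Sum>i\<le>degree (vf_coeff X). coeff (vf_coeff X) i *\<^sub>R vf i)"
    by (simp add: vf_coeff_inject)
  then show ?thesis
    by (metis (no_types, lifting) rangeI span_base span_scale span_sum)
qed

lemma exterior_power_3_vf:
  "exterior_power 3 = span {wedge [vf i, vf j, vf k] | i j k. True}" (is "_ = span ?C")
proof
  have "wedge [X, Y, Z] \<in> span ?C" for X Y Z
  proof (rule linear_span_closed[OF linear_wedge_3(1) _ vf_span], clarify)
    fix i
    show "wedge [vf i, Y, Z] \<in> span ?C"
    proof (rule linear_span_closed[OF linear_wedge_3(2) _ vf_span], clarify)
      fix j
      show "wedge [vf i, vf j, Z] \<in> span ?C"
        by (rule linear_span_closed[OF linear_wedge_3(3) _ vf_span], clarify)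
          (blast intro: span_base)
    qed
  qed
  then show "exterior_power 3 \<subseteq> span ?C"
    unfolding exterior_power_def
    by (intro span_minimal) (auto simp: numeral_3_eq_3 length_Suc_conv)
  show "span ?C \<subseteq> exterior_power 3"
    unfolding exterior_power_def by (rule span_mono) auto
qed

lemma weight_decomposition:
  assumes "z \<in> exterior_power 3"
  obtains f n where "\<And>N. f N \<in> weight_space N" "z = (\<Sum>N<n. f N)"
proof -
  \<comment> \<open>Requiring \<open>f\<close> to vanish from \<open>n\<close> on allows sums of different lengths to be added.\<close>
  let ?P = "\<lambda>z. \<exists>f n. (\<forall>N. f N \<in> weight_space N) \<and> (\<forall>N\<ge>n. f N = 0) \<and> z = (\<Sum>N<n. f N)"
  have sub: "subspace (weight_space N)" for N by (simp add: weight_space_def)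
  have "?P z"
    using assms unfolding exterior_power_3_vf
  proof (rule span_induct)
    show "subspace {z. ?P z}"
    proof (rule real_vector.subspaceI; clarify)
      show "?P 0" by (rule exI[of _ "\<lambda>_. 0"], rule exI[of _ 0]) (simp add: subspace_0[OF sub])
      fix f n
      assume f: "\<forall>N. f N \<in> weight_space N" "\<forall>N\<ge>n. f N = 0"
      show "?P (c *\<^sub>R (\<Sum>N<n. f N))" for c
        by (rule exI[of _ "\<lambda>N. c *\<^sub>R f N"], rule exI[of _ n])
          (simp add: f scaleR_sum_right subspace_scale[OF sub])
      fix g m
      assume g: "\<forall>N. g N \<in> weight_space N" "\<forall>N\<ge>m. g N = 0"
      have "(\<Sum>N<n. f N) = (\<Sum>N<max n m. f N)" "(\<Sum>N<m. g N) = (\<Sum>N<max n m. g N)"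
        by (rule sum.mono_neutral_left; use f g in auto)+
      then show "?P ((\<Sum>N<n. f N) + (\<Sum>N<m. g N))"
        by (intro exI[of _ "\<lambda>N. f N + g N"] exI[of _ "max n m"])
          (simp add: f g sum.distrib subspace_add[OF sub])
    qed
    fix z assume "z \<in> {wedge [vf i, vf j, vf k] | i j k. True}"
    then obtain i j k where z: "z = wedge [vf i, vf j, vf k]" by blast
    have "z \<in> weight_space (i + j + k)"
      unfolding weight_space_def by (rule span_base) (use z in blast)
    then show "?P z"
      by (intro exI[of _ "\<lambda>N. if N = i + j + k then z else 0"] exI[of _ "Suc (i + j + k)"])
        (auto simp: subspace_0[OF sub])
  qed
  then show thesis using that by blast
qed

text \<open>Eigenvectors for distinct eigenvalues are independent.\<close>

lemma eigenvectors_sum_0: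
  fixes f :: "'v::real_vector \<Rightarrow> 'v"
  assumes f: "linear f" and "finite S" "inj_on w S"
    and "\<And>i. i \<in> S \<Longrightarrow> f (v i) = w i *\<^sub>R v i" "(\<Sum>i\<in>S. v i) = 0"
  shows "\<forall>i\<in>S. v i = 0"
  using assms(2-)
proof (induction S arbitrary: v rule: finite_induct)
  case (insert a S)
  \<comment> \<open>Apply \<open>f - w a\<close> to the relation; this removes the term of \<open>a\<close>.\<close>
  have "(\<Sum>i\<in>S. (w i - w a) *\<^sub>R v i) = (\<Sum>i\<in>insert a S. (w i - w a) *\<^sub>R v i)"
    using insert.hyps by simp
  also have "\<dots> = (\<Sum>i\<in>insert a S. f (v i)) - w a *\<^sub>R (\<Sum>i\<in>insert a S. v i)"
    by (simp only: scaleR_sum_right sum_subtractf[symmetric])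
      (intro sum.cong refl, simp add: insert.prems(2) scaleR_diff_left)
  also have "(\<Sum>i\<in>insert a S. f (v i)) = f (\<Sum>i\<in>insert a S. v i)"
    by (simp only: linear_sum[OF f])
  also have "\<dots> - w a *\<^sub>R (\<Sum>i\<in>insert a S. v i) = 0"
    by (simp only: insert.prems(3) linear_0[OF f]) simp
  finally have "(\<Sum>i\<in>S. (w i - w a) *\<^sub>R v i) = 0" .
  then have "\<forall>i\<in>S. (w i - w a) *\<^sub>R v i = 0"
    using insert.prems(1,2) by (intro insert.IH) (auto simp: linear_scale[OF f] scaleR_left_commute)
  moreover have "w i \<noteq> w a" if "i \<in> S" for i
    using inj_onD[OF insert.prems(1), of i a] insert.hyps(2) that by blast
  ultimately have *: "\<forall>i\<in>S. v i = 0" by simp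
  moreover have "v a = 0" using insert.prems(3) insert.hyps * by simp
  ultimately show ?case by simp
qed simp

text \<open>
  A nonzero wedge of weight 0 has distinct exponents with sum 3, which are therefore 0, 1, 2 in some
  order.
\<close>

lemma weight_space_3: "weight_space 3 \<subseteq> span {wedge [vf 0, vf 1, vf 2]}"
  unfolding weight_space_def
proof (rule span_minimal, clarify)
  fix i j k :: nat
  let ?w = "wedge [vf 0, vf 1, vf 2]"
  assume "i + j + k = 3"
  then have "i = 0 \<or> i = 1 \<or> i = 2 \<or> i = 3" "j = 0 \<or> j = 1 \<or> j = 2 \<or> j = 3" by linarith+
  with \<open>i + j + k = 3\<close> have "i = j \<or> j = k \<or> i = k \<or> (i = 0 \<and> j = 1 \<and> k = 2) \<or> (i = 0 \<and> j = 2 \<and> k = 1)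
      \<or> (i = 1 \<and> j = 0 \<and> k = 2) \<or> (i = 1 \<and> j = 2 \<and> k = 0)
      \<or> (i = 2 \<and> j = 0 \<and> k = 1) \<or> (i = 2 \<and> j = 1 \<and> k = 0)"
    using \<open>i = 0 \<or> i = 1 \<or> i = 2 \<or> i = 3\<close> \<open>j = 0 \<or> j = 1 \<or> j = 2 \<or> j = 3\<close>
    by (elim disjE) simp_all
  then have "wedge [vf i, vf j, vf k] \<in> {0, ?w, - ?w}"
    using wedge_swap(2)[of "vf 1" "vf 0" "vf 2"] wedge_swap(3)[of "vf 0" "vf 2" "vf 1"]
      wedge_swap(3)[of "vf 1" "vf 2" "vf 0"] wedge_swap(2)[of "vf 2" "vf 0" "vf 1"]
      wedge_swap(2)[of "vf 2" "vf 1" "vf 0"]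
    by (elim disjE conjE) (simp_all add: wedge_repeated)
  moreover have "{0, ?w, - ?w} \<subseteq> span {?w}"
    by (auto simp: span_zero span_base span_neg)
  ultimately show "wedge [vf i, vf j, vf k] \<in> span {?w}" by blast
qed simp

text \<open>
  The boundary of a cycle is the sum of the boundaries of its weight components, which are
  eigenvectors for distinct eigenvalues, so each component is a cycle. By Cartan's formula a cycle
  of weight \<open>N - 3 \<noteq> 0\<close> is a boundary, and only the component of weight 0 is left.
\<close>

lemma cycle_3_homologous_gv:
  assumes "z \<in> exterior_power 3" "lie_d lie_bracket z = 0"
  obtains c where "z - c *\<^sub>R wedge [vf 0, vf 1, vf 2] \<in> lie_d lie_bracket ` exterior_power 4"
proof -
  let ?d = "lie_d lie_bracket :: poly_vector_field exterior \<Rightarrow> _"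
  let ?B = "?d ` exterior_power 4"
  obtain f n where f: "\<And>N. f N \<in> weight_space N" and z: "z = (\<Sum>N<n. f N)"
    using weight_decomposition[OF assms(1)] by blast
  have "\<forall>N\<in>{..<n}. ?d (f N) = 0"
  proof (rule eigenvectors_sum_0[OF linear_lie_derivative])
    show "lie_derivative (vf 1) (?d (f N)) = (real N - 3) *\<^sub>R ?d (f N)" for N
      by (rule weight_space_eigen(2)[OF f])
    show "(\<Sum>N<n. ?d (f N)) = 0"
      using assms(2) unfolding z by (simp add: linear_sum[OF linear_lie_d_bracket])
  qed (auto simp: inj_on_def)
  then have bd: "f N \<in> ?B" if "N < n" "N \<noteq> 3" for N
  proof -
    have "(real N - 3) *\<^sub>R f N = ?d (wedge_left (vf 1) (f N)) + wedge_left (vf 1) (?d (f N))"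
      using weight_space_eigen(1)[OF f, of N] by (simp add: lie_derivative_def)
    also have "?d (f N) = 0" using \<open>\<forall>N\<in>_. _\<close> that by simp
    finally have "(real N - 3) *\<^sub>R f N = ?d (wedge_left (vf 1) (f N))"
      by (simp add: linear_0[OF linear_wedge_left])
    moreover have "wedge_left (vf 1) (f N) \<in> exterior_power 4"
      using wedge_left_exterior_power[OF weight_space_eigen(3)[OF f]] by (simp add: eval_nat_numeral)
    ultimately have "(real N - 3) *\<^sub>R f N \<in> ?B" by (metis imageI)
    from subspace_scale[OF subspace_boundaries[OF linear_lie_d_bracket] this, of "inverse (real N - 3)"]
    show ?thesis using that by simp
  qed
  define g where "g = (if 3 < n then f 3 else 0)"
  have "z - g = (\<Sum>N\<in>{..<n} - {3}. f N)"
    unfolding z g_def by (auto simp: sum_diff1)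
  also have "\<dots> \<in> ?B"
    by (intro subspace_sum[OF subspace_boundaries[OF linear_lie_d_bracket]]) (use bd in auto)
  finally have "z - g \<in> ?B" .
  moreover have "g \<in> span {wedge [vf 0, vf 1, vf 2]}"
    using weight_space_3 f[of 3] by (auto simp: g_def span_zero)
  ultimately show thesis
    using that by (auto simp: span_singleton)
qed


section \<open>Detecting the Godbillon-Vey class\<close>

definition gv_functional :: "poly_vector_field uea cyclic_tensor \<Rightarrow> real" where
  "gv_functional = cyclic_cochain gv_cochain"

lemma trilinear_gv_cochain: "trilinear gv_cochain"
  by (rule trilinear.intro) (rule linear_gv_cochain)+

lemma linear_gv_functional: "linear gv_functional"
  unfolding gv_functional_def
  by (rule trilinear.linear_cyclic_cochain[OF trilinear_gv_cochain])

lemma gv_functional_boundary: "x \<in> cyclic_chains 3 \<Longrightarrow> gv_functional (cyclic_b x) = 0"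
  unfolding gv_functional_def
  by (rule cyclic_cochain_boundary[of _ counit, OF trilinear_gv_cochain gv_cochain_cocycle])

lemma gv_functional_theta:
  "gv_functional (theta (wedge (map uea_incl [vf 0, vf 1, vf 2]))) = -2"
proof -
  interpret trilinear gv_cochain by (rule trilinear_gv_cochain)
  show ?thesis
    by (simp add: gv_functional_def theta_wedge theta_list_3 linear_diff[OF linear_cyclic_cochain]
        cyclic_cochain_cyc cyclic_sum_3 gv_cochain_incl vf_def Vector_Field_inverse pderiv_monom
        poly_monom)
qed

lemma gv_functional_theta_boundary:
  assumes "x \<in> lie_d commutator ` exterior_power 4"
  shows "gv_functional (theta x) = 0"
proof -
  from assms obtain y where y: "x = lie_d commutator y" "y \<in> exterior_power 4" by blast
  have "theta y \<in> cyclic_chains 3" using y(2) by (intro theta_cyclic_chains) (simp add: eval_nat_numeral)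
  then show ?thesis
    using y gv_functional_boundary[of "theta y"] by (simp add: theta_chain_map)
qed

definition gv_cycle :: "poly_vector_field exterior" where
  "gv_cycle = wedge [vf 0, vf 1, vf 2]"

lemma gv_cycle_cycle: "gv_cycle \<in> cycles exterior_power (lie_d lie_bracket) 3"
proof -
  have "wedge [vf 1, vf 1] = 0"
    using alternating_nth[OF alternating_wedge, of 0 "[vf 1, vf 1]"] by simp
  then have "lie_d lie_bracket gv_cycle = 0"
    by (simp add: gv_cycle_def lie_d_bracket_wedge lie_d_list_3 lie_bracket_vf
        linear_scale[OF linear_wedge_2(1)] numeral_2_eq_2)
  moreover have "gv_cycle \<in> exterior_power 3"
    unfolding exterior_power_def gv_cycle_def by (intro span_base imageI) simp
  ultimately show ?thesis by (simp add: cycles_def)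
qed

text \<open>
  An induced map takes a class to the union of the classes of the images of its representatives. The
  functional is constant on this union, since it kills boundaries in the cyclic complex, pulls
  back along \<open>\<theta>\<close> to a functional that kills boundaries of \<open>U(W)\<close>, and hence pulls back along \<open>\<mu>\<^sub>2\<close> to
  one that kills boundaries of \<open>W\<close>.
\<close>

lemma gv_functional_on_image:
  assumes "c *\<^sub>R gv_cycle \<in> X" and "\<And>z. z \<in> X \<Longrightarrow> z - c *\<^sub>R gv_cycle \<in> lie_d lie_bracket ` exterior_power 4"
    and "t \<in> (theta_star 2 \<circ> mu2 3) X"
  shows "gv_functional t = - 2 * c"
proof -
  note F = linear_diff[OF linear_gv_functional] linear_diff[OF linear_theta]
  obtain y where y: "y \<in> mu2 3 X" "theta y - t \<in> cyclic_b ` cyclic_chains 3"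
    using assms(3) unfolding comp_apply theta_star_def by (rule induced_mapE) simp
  obtain z where z: "z \<in> X" "mu z - y \<in> lie_d commutator ` exterior_power 4"
    using y(1) unfolding mu2_def lie_homology_map_def mu_def[symmetric] by (rule induced_mapE) simp
  have "gv_functional (theta y - t) = 0"
    using y(2) by (auto simp: gv_functional_boundary)
  then have "gv_functional t = gv_functional (theta y)" by (simp add: F)
  also have "\<dots> = gv_functional (theta (mu z))"
    using gv_functional_theta_boundary[OF z(2)] by (simp add: F)
  also have "\<dots> = gv_functional (theta (mu (c *\<^sub>R gv_cycle)))"
  proof -
    obtain b where b: "z - c *\<^sub>R gv_cycle = lie_d lie_bracket b" "b \<in> exterior_power 4"
      using assms(2)[OF z(1)] by blast
    have "mu b \<in> exterior_power 4"
      unfolding mu_def by (rule exterior_map_exterior_power[OF linear_uea_incl b(2)])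
    then have "mu (z - c *\<^sub>R gv_cycle) \<in> lie_d commutator ` exterior_power 4"
      unfolding b(1) mu_chain_map[symmetric] by (rule imageI)
    from gv_functional_theta_boundary[OF this] show ?thesis
      by (simp add: F linear_diff[OF linear_mu])
  qed
  also have "\<dots> = - 2 * c"
    using gv_functional_theta
    by (simp add: mu_def gv_cycle_def exterior_map_wedge[OF linear_uea_incl] linear_scale[OF linear_gv_functional]
        linear_scale[OF linear_theta] linear_scale[OF linear_exterior_map[OF linear_uea_incl]])
  finally show ?thesis .
qed

lemma theta_mu_cycle_in_image:
  fixes z :: "poly_vector_field exterior"
  assumes "z \<in> X" "z \<in> cycles exterior_power (lie_d lie_bracket) 3"
  shows "theta (mu z) \<in> (theta_star 2 \<circ> mu2 3) X"
proof -
  have z: "z \<in> exterior_power 3" "lie_d lie_bracket z = 0" using assms(2) by (auto simp: cycles_def)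
  have mu: "mu z \<in> exterior_power 3" "lie_d commutator (mu z) = 0"
    using exterior_map_exterior_power[OF linear_uea_incl z(1)]
    by (simp_all add: mu_def[symmetric] mu_chain_map z(2) linear_0[OF linear_mu])
  have "mu z \<in> mu2 3 X"
    unfolding mu2_def lie_homology_map_def mu_def[symmetric]
    by (rule induced_mapI[OF assms(1)])
      (use mu subspace_0[OF subspace_boundaries[OF linear_lie_d_commutator]] in \<open>auto simp: cycles_def\<close>)
  moreover have "theta (mu z) \<in> cycles cyclic_chains cyclic_b 2"
    using theta_cyclic_chains[of "mu z" 2] mu
    by (simp add: cycles_def theta_chain_map linear_0[OF linear_theta] eval_nat_numeral)
  moreover have "0 \<in> cyclic_b ` cyclic_chains (Suc 2)"
    using linear_0[OF linear_cyclic_b] span_zero unfolding cyclic_chains_def by (metis imageI)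
  ultimately show ?thesis
    unfolding comp_apply theta_star_def by (intro induced_mapI)
qed

theorem corollary3p4:
  "inj_on (theta_star 2 \<circ> mu2 3)
     (lie_homology lie_bracket 3 :: poly_vector_field exterior set set)"
proof -
  let ?Z = "cycles exterior_power (lie_d lie_bracket) 3 :: poly_vector_field exterior set"
  let ?R = "homologous exterior_power (lie_d lie_bracket) 3 :: (poly_vector_field exterior \<times> _) set"
  have eq: "equiv ?Z ?R"
    by (intro equiv_homologous linear_lie_d_bracket subspace_exterior_power)
  have rep: "\<exists>c. c *\<^sub>R gv_cycle \<in> ?Z \<and> X = ?R `` {c *\<^sub>R gv_cycle}"
    if X: "X \<in> lie_homology lie_bracket 3" for X :: "poly_vector_field exterior set"
  proof -
    obtain x where x: "x \<in> ?Z" "X = ?R `` {x}"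
      using X unfolding lie_homology_def homology_def by (rule quotientE)
    then obtain c where c: "x - c *\<^sub>R gv_cycle \<in> lie_d lie_bracket ` exterior_power 4"
      using cycle_3_homologous_gv unfolding gv_cycle_def cycles_def by blast
    have cZ: "c *\<^sub>R gv_cycle \<in> ?Z"
      using gv_cycle_cycle
      by (simp add: cycles_def linear_scale[OF linear_lie_d_bracket]
          subspace_scale[OF subspace_exterior_power])
    with x c have "(x, c *\<^sub>R gv_cycle) \<in> ?R"
      by (simp add: homologous_def eval_nat_numeral)
    then have "?R `` {x} = ?R `` {c *\<^sub>R gv_cycle}" by (rule equiv_class_eq[OF eq])
    with x(2) cZ show ?thesis by blast
  qed
  show ?thesis
  proof (rule inj_onI)
    fix X Y :: "poly_vector_field exterior set"
    assume X: "X \<in> lie_homology lie_bracket 3" and Y: "Y \<in> lie_homology lie_bracket 3"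
      and XY: "(theta_star 2 \<circ> mu2 3) X = (theta_star 2 \<circ> mu2 3) Y"
    obtain c where c: "c *\<^sub>R gv_cycle \<in> ?Z" "X = ?R `` {c *\<^sub>R gv_cycle}" using rep[OF X] by blast
    obtain c' where c': "c' *\<^sub>R gv_cycle \<in> ?Z" "Y = ?R `` {c' *\<^sub>R gv_cycle}" using rep[OF Y] by blast
    have val: "gv_functional t = - 2 * k"
      if "k *\<^sub>R gv_cycle \<in> ?Z" "W = ?R `` {k *\<^sub>R gv_cycle}" "t \<in> (theta_star 2 \<circ> mu2 3) W" for t k W
    proof (rule gv_functional_on_image[OF _ _ that(3)])
      show "k *\<^sub>R gv_cycle \<in> W" using equiv_class_self[OF eq that(1)] that(2) by simp
      fix z assume "z \<in> W"
      then have "(z, k *\<^sub>R gv_cycle) \<in> ?R"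
        using that(2) eq by (auto simp: equiv_def dest: symD)
      then show "z - k *\<^sub>R gv_cycle \<in> lie_d lie_bracket ` exterior_power 4"
        by (auto simp: homologous_def eval_nat_numeral)
    qed
    have "c *\<^sub>R gv_cycle \<in> X" using equiv_class_self[OF eq c(1)] c(2) by simp
    from theta_mu_cycle_in_image[OF this c(1)] have "- 2 * c = - 2 * c'"
      using val[OF c] val[OF c'] XY by metis
    then show "X = Y" using c c' by simp
  qed
qed

end
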